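(* Let $\Bbbk$ be a field with $\mathrm{char}(\Bbbk)\neq 2$. Let $((\mathfrak{R},F),\mathfrak{R}_+,\mathfrak{R}_-)$ be a Manin triple over $\Bbbk$ determining a Lie bialgebra cobracket $\delta:\mathfrak{R}_+\to\wedge^2(\mathfrak{R}_+)$. Let $$\mathsf{MT}(\mathfrak{R},\mathfrak{R}_+;\mathfrak{R}_-):=\{\mathfrak{W}\subset\mathfrak{R}\;|\;(\mathfrak{R},\mathfrak{R}_+,\mathfrak{W})\text{ is a Manin triple (with respect to }F)\text{ and }\mathfrak{W}\asymp\mathfrak{R}_-\}.$$ For $\mathtt{t}=\sum_{i=1}^n a_i\otimes b_i\in\wedge^2(\mathfrak{R}_+)$ let $f_{\mathtt{t}}:\mathfrak{R}_-\to\mathfrak{R}_+$, $f_{\mathtt{t}}(w)=\sum_{i=1}^nF(w,a_i)b_i$, and $\mathfrak{R}_-^{\mathtt{t}}:=\{w+f_{\mathtt{t}}(w)\,|\,w\in\mathfrak{R}_-\}\subset\mathfrak{R}$. Then for $\mathtt{t}\in\wedge^2(\mathfrak{R}_+)$ the subspace $\mathfrak{R}_-^{\mathtt{t}}$ is a Lie subalgebra of $\mathfrak{R}$ if and only if $\mathtt{t}$ satisfies the twist equation $$\mathrm{alt}\bigl((\delta\otimes\mathbb{1})(\mathtt{t})\bigr)-[[\mathtt{t},\mathtt{t}]]=0,$$ and the map $$\bigl\{\mathtt{t}\in\wedge^2(\mathfrak{R}_+)\,\big|\,\mathrm{alt}\bigl((\delta\otimes\mathbb{1})(\mathtt{t})\bigr)-[[\mathtt{t},\mathtt{t}]]=0\bigr\}\longrightarrow\mathsf{MT}(\mathfrak{R},\mathfrak{R}_+;\mathfrak{R}_-),\qquad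 \mathtt{t}\mapsto\mathfrak{R}_-^{\mathtt{t}},$$ is a bijection. Moreover, for such $\mathtt{t}$ the Lie bialgebra cobracket $\delta_{\mathtt{t}}=\delta+\partial_{\mathtt{t}}:\mathfrak{R}_+\to\wedge^2(\mathfrak{R}_+)$ is determined by the Manin triple $\mathfrak{R}=\mathfrak{R}_+\dotplus\mathfrak{R}_-^{\mathtt{t}}$.
   Context: All vector spaces may be infinite dimensional; $\otimes$ is over $\Bbbk$; $\dotplus$ is the inner direct sum of vector subspaces. $\wedge^2(V)\subset V\otimes V$ is the space of skew-symmetric tensors. For a Lie algebra $\mathfrak{r}$, $a\in\mathfrak{r}$, $\mathtt{t}\in\mathfrak{r}^{\otimes n}$: $a\circ\mathtt{t}:=[a\otimes1\otimes\dots\otimes1+\dots+1\otimes\dots\otimes1\otimes a,\mathtt{t}]$ (diagonal adjoint action). For $\mathtt{t}\in\mathfrak{r}^{\otimes2}$: $\partial_{\mathtt{t}}(a):=a\circ\mathtt{t}$. $\mathrm{alt}(a\otimes b\otimes c):=a\otimes b\otimes c+c\otimes a\otimes b+b\otimes c\otimes a$. $[[\mathtt{t},\mathtt{t}]]:=[\mathtt{t}^{12},\mathtt{t}^{13}]+[\mathtt{t}^{12},\mathtt{t}^{23}]+[\mathtt{t}^{13},\mathtt{t}^{23}]\in\mathfrak{r}^{\otimes3}$, where $[(a\otimes b)^{12},(c\otimes d)^{13}]=[a,c]\otimes b\otimes d$, $[(a\otimes b)^{12},(c\otimes d)^{23}]=a\otimes[b,c]\otimes d$, $[(a\otimes b)^{13},(c\otimes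 d)^{23}]=a\otimes c\otimes[b,d]$. A Lie bialgebra is a pair $(\mathfrak{r},\delta)$ where $\delta:\mathfrak{r}\to\mathfrak{r}\otimes\mathfrak{r}$ is linear with image in $\wedge^2(\mathfrak{r})$, satisfies $\delta([a,b])=a\circ\delta(b)-b\circ\delta(a)$, and $\mathrm{alt}((\delta\otimes\mathbb{1})\circ\delta)=0$. Two subspaces $W',W''$ are commensurable, $W'\asymp W''$, if $\dim_{\Bbbk}((W'+W'')/(W'\cap W''))<\infty$. A Manin triple $((\mathfrak{R},F),\mathfrak{R}_+,\mathfrak{R}_-)$ consists of a Lie algebra $\mathfrak{R}$ with a symmetric invariant ($F([a,b],c)=F(a,[b,c])$) non-degenerate bilinear form $F$ and Lie subalgebras $\mathfrak{R}_\pm$ with $\mathfrak{R}=\mathfrak{R}_+\dotplus\mathfrak{R}_-$ and $\mathfrak{R}_\pm\subseteq\mathfrak{R}_\pm^\perp$. A Lie bialgebra cobracket $\delta$ on $\mathfrak{R}_+$ is determined by this Manin triple if $F(\delta(a),b_1\otimes b_2)=F(a,[b_1,b_2])$ for all $a\in\mathfrak{R}_+$, $b_1,b_2\in\mathfrak{R}_-$, where $F(a_1\otimes a_2,b_1\otimes b_2)=F(a_1,b_1)F(a_2,b_2)$. *)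

theory Defs
  imports Complex_Main "HOL-Library.Function_Algebras"
begin

section \<open>Tensor products of vector spaces\<close>

text \<open>
  A vector space is a type \<open>'v\<close> with a scalar multiplication \<open>s\<close> such that \<open>vector_space s\<close>; it may be
  infinite dimensional. The tensor product of two vector spaces is realised inside the space of
  functions of pairs of linear functionals: \<open>a \<otimes> b\<close> is \<open>(\<phi>, \<psi>) \<mapsto> \<phi> a * \<psi> b\<close>, which is
  independent of any choice of bases. That this is the tensor product (also of two subspaces) is the
  universal property: \<open>tens_bilinear\<close> and \<open>tensor_lift_eq\<close> below. Since everything lives over a
  field, the tensor product of subspaces is a subspace of the tensor product of the ambient spaces.
\<close>

type_synonym ('k, 'v, 'w) tensor = "('v \<Rightarrow> 'k) \<Rightarrow> ('w \<Rightarrow> 'k) \<Rightarrow> 'k"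

type_synonym ('k, 'v) tensor2 = "('k, 'v, 'v) tensor"

text \<open>Threefold tensors are elements of \<open>(V \<otimes> V) \<otimes> V\<close>.\<close>

type_synonym ('k, 'v) tensor3 = "('k, ('k, 'v) tensor2, 'v) tensor"

definition tscale :: "'k::field \<Rightarrow> ('k, 'v, 'w) tensor \<Rightarrow> ('k, 'v, 'w) tensor"
  where "tscale c t = (\<lambda>\<phi> \<psi>. c * t \<phi> \<psi>)"

definition tens ::
  "('k::field \<Rightarrow> 'v::ab_group_add \<Rightarrow> 'v) \<Rightarrow> ('k \<Rightarrow> 'w::ab_group_add \<Rightarrow> 'w) \<Rightarrow> 'v \<Rightarrow> 'w \<Rightarrow> ('k, 'v, 'w) tensor"
  where "tens s1 s2 a b =
    (\<lambda>\<phi> \<psi>. if Vector_Spaces.linear s1 (*) \<phi> \<and> Vector_Spaces.linear s2 (*) \<psi> then \<phi> a * \<psi> b else 0)"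

definition tensor_prod ::
  "('k::field \<Rightarrow> 'v::ab_group_add \<Rightarrow> 'v) \<Rightarrow> 'v set \<Rightarrow> ('k \<Rightarrow> 'w::ab_group_add \<Rightarrow> 'w) \<Rightarrow> 'w set
    \<Rightarrow> ('k, 'v, 'w) tensor set"
  where "tensor_prod s1 S1 s2 S2 =
    {t. \<exists>(n::nat) a b. (\<forall>i<n. a i \<in> S1 \<and> b i \<in> S2) \<and> t = (\<Sum>i<n. tens s1 s2 (a i) (b i))}"

text \<open>
  For \<open>t = \<Sum>\<^sub>i a\<^sub>i \<otimes> b\<^sub>i\<close> in the tensor product of \<open>S1\<close> and \<open>S2\<close>, \<open>tensor_lift s1 S1 s2 S2 \<beta> t\<close> is
  \<open>\<Sum>\<^sub>i \<beta> a\<^sub>i b\<^sub>i\<close>, that is, the linear map induced by \<open>\<beta>\<close>. If \<open>\<beta>\<close> is bilinear on \<open>S1 \<times> S2\<close>,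
  this does not depend on the representation of \<open>t\<close>, see \<open>tensor_lift_eq\<close>.
\<close>

definition tensor_lift ::
  "('k::field \<Rightarrow> 'v::ab_group_add \<Rightarrow> 'v) \<Rightarrow> 'v set \<Rightarrow> ('k \<Rightarrow> 'w::ab_group_add \<Rightarrow> 'w) \<Rightarrow> 'w set
    \<Rightarrow> ('v \<Rightarrow> 'w \<Rightarrow> 'u::comm_monoid_add) \<Rightarrow> ('k, 'v, 'w) tensor \<Rightarrow> 'u"
  where "tensor_lift s1 S1 s2 S2 \<beta> t =
    (THE x. \<exists>(n::nat) a b. (\<forall>i<n. a i \<in> S1 \<and> b i \<in> S2) \<and>
       t = (\<Sum>i<n. tens s1 s2 (a i) (b i)) \<and> x = (\<Sum>i<n. \<beta> (a i) (b i)))"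

definition bilinear_on ::
  "('k::field \<Rightarrow> 'v::ab_group_add \<Rightarrow> 'v) \<Rightarrow> 'v set \<Rightarrow> ('k \<Rightarrow> 'w::ab_group_add \<Rightarrow> 'w) \<Rightarrow> 'w set
    \<Rightarrow> ('k \<Rightarrow> 'u::ab_group_add \<Rightarrow> 'u) \<Rightarrow> ('v \<Rightarrow> 'w \<Rightarrow> 'u) \<Rightarrow> bool"
  where "bilinear_on s1 S1 s2 S2 s3 \<beta> \<longleftrightarrow>
    (\<forall>x\<in>S1. \<forall>x'\<in>S1. \<forall>y\<in>S2. \<beta> (x + x') y = \<beta> x y + \<beta> x' y) \<and>
    (\<forall>x\<in>S1. \<forall>y\<in>S2. \<forall>y'\<in>S2. \<beta> x (y + y') = \<beta> x y + \<beta> x y') \<and>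
    (\<forall>c. \<forall>x\<in>S1. \<forall>y\<in>S2. \<beta> (s1 c x) y = s3 c (\<beta> x y) \<and> \<beta> x (s2 c y) = s3 c (\<beta> x y))"

lemma vector_space_mult: "vector_space ((*) :: 'k::field \<Rightarrow> 'k \<Rightarrow> 'k)"
  by unfold_locales (auto simp: algebra_simps)

lemma vector_space_tscale: "vector_space (tscale :: 'k::field \<Rightarrow> ('k, 'v, 'w) tensor \<Rightarrow> _)"
  by unfold_locales (auto simp: tscale_def algebra_simps fun_eq_iff)

lemma linear_functionalD:
  assumes "Vector_Spaces.linear s (*) \<phi>"
  shows "\<phi> (x + y) = \<phi> x + \<phi> y" "\<phi> (s c x) = c * \<phi> x" "\<phi> 0 = 0" "\<phi> (sum f A) = (\<Sum>i\<in>A. \<phi> (f i))"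
proof -
  interpret Vector_Spaces.linear s "(*)" \<phi> by fact
  show "\<phi> (x + y) = \<phi> x + \<phi> y" "\<phi> (s c x) = c * \<phi> x" "\<phi> 0 = 0" "\<phi> (sum f A) = (\<Sum>i\<in>A. \<phi> (f i))"
    by (simp_all add: add scale zero sum)
qed

lemma tens_bilinear: "bilinear_on s1 UNIV s2 UNIV tscale (tens s1 s2)"
proof -
  have "tens s1 s2 (x + x') y \<phi> \<psi> = tens s1 s2 x y \<phi> \<psi> + tens s1 s2 x' y \<phi> \<psi> \<and>
        tens s1 s2 x (y + y') \<phi> \<psi> = tens s1 s2 x y \<phi> \<psi> + tens s1 s2 x y' \<phi> \<psi> \<and>
        tens s1 s2 (s1 c x) y \<phi> \<psi> = c * tens s1 s2 x y \<phi> \<psi> \<and>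
        tens s1 s2 x (s2 c y) \<phi> \<psi> = c * tens s1 s2 x y \<phi> \<psi>" for x x' y y' c \<phi> \<psi>
  proof (cases "Vector_Spaces.linear s1 (*) \<phi> \<and> Vector_Spaces.linear s2 (*) \<psi>")
    case True
    then show ?thesis
      using linear_functionalD(1,2)[of s1 \<phi>] linear_functionalD(1,2)[of s2 \<psi>]
      by (simp add: tens_def algebra_simps)
  next
    case False
    then show ?thesis by (auto simp: tens_def)
  qed
  then show ?thesis by (simp add: bilinear_on_def tscale_def fun_eq_iff)
qed

lemma sum_fun_apply2: "sum f A \<phi> \<psi> = (\<Sum>i\<in>A. f i \<phi> \<psi>)"
  by (induction A rule: infinite_finite_induct) auto

lemma functional_separates:
  assumes "vector_space s" and "\<And>\<phi>. Vector_Spaces.linear s (*) \<phi> \<Longrightarrow> \<phi> x = \<phi> y"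
  shows "x = y"
proof (rule ccontr)
  assume "x \<noteq> y"
  interpret vector_space s by fact
  interpret p: vector_space_pair s "(*)"
    by (intro vector_space_pair.intro assms(1) vector_space_mult)
  have "independent {x - y}" using \<open>x \<noteq> y\<close> by simp
  then obtain \<phi> where \<phi>: "Vector_Spaces.linear s (*) \<phi>" "\<phi> (x - y) = 1"
    using p.linear_independent_extend[of "{x - y}" "\<lambda>_. 1"] by auto
  interpret \<phi>: Vector_Spaces.linear s "(*)" \<phi> by fact
  show False using assms(2)[OF \<phi>(1)] \<phi>(2) by (simp add: \<phi>.diff)
qed

lemma tens_sum_unique:
  fixes s1 :: "'k::field \<Rightarrow> 'v::ab_group_add \<Rightarrow> 'v"
    and s2 :: "'k \<Rightarrow> 'w::ab_group_add \<Rightarrow> 'w"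
    and s3 :: "'k \<Rightarrow> 'u::ab_group_add \<Rightarrow> 'u"
  assumes V: "vector_space s1" "vector_space s2" "vector_space s3"
    and S: "module.subspace s1 S1" "module.subspace s2 S2"
    and \<beta>: "bilinear_on s1 S1 s2 S2 s3 \<beta>"
    and ab: "\<And>i. i < (n::nat) \<Longrightarrow> a i \<in> S1 \<and> b i \<in> S2"
    and cd: "\<And>i. i < (m::nat) \<Longrightarrow> c i \<in> S1 \<and> d i \<in> S2"
    and eq: "(\<Sum>i<n. tens s1 s2 (a i) (b i)) = (\<Sum>i<m. tens s1 s2 (c i) (d i))"
  shows "(\<Sum>i<n. \<beta> (a i) (b i)) = (\<Sum>i<m. \<beta> (c i) (d i))"
proof -
  interpret v1: vector_space s1 by fact
  interpret v2: vector_space s2 by fact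
  interpret v3: vector_space s3 by fact
  interpret p: vector_space_pair s2 "(*)"
    by (intro vector_space_pair.intro V vector_space_mult)
  let ?G = "b ` {..<n} \<union> d ` {..<m}"
  obtain B where B: "B \<subseteq> ?G" "v2.independent B" "?G \<subseteq> v2.span B"
    by (rule v2.basis_exists)
  have finB: "finite B" using B(1) by (rule finite_subset) simp
  have BS: "B \<subseteq> S2" using B(1) ab cd by auto
  define r where "r = v2.representation B"
  have expand: "(\<Sum>e\<in>B. s2 (r y e) e) = y" if "y \<in> ?G" for y
    unfolding r_def using v2.sum_representation_eq[OF B(2) _ finB order_refl] B(3) that by blast
  have \<beta>0r: "\<beta> x 0 = 0" if "x \<in> S1" for x
  proof -
    have "\<beta> x (s2 0 0) = s3 0 (\<beta> x 0)"
      using \<beta> that v2.subspace_0[OF S(2)] unfolding bilinear_on_def by blast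
    then show ?thesis by simp
  qed
  have \<beta>0l: "\<beta> 0 y = 0" if "y \<in> S2" for y
  proof -
    have "\<beta> (s1 0 0) y = s3 0 (\<beta> 0 y)"
      using \<beta> that v1.subspace_0[OF S(1)] unfolding bilinear_on_def by blast
    then show ?thesis by simp
  qed
  have \<beta>sr: "\<beta> x (sum g A) = (\<Sum>i\<in>A. \<beta> x (g i))" if "x \<in> S1" "\<And>i. i \<in> A \<Longrightarrow> g i \<in> S2"
    for x and g :: "'w \<Rightarrow> 'w" and A
    using that(2)
  proof (induction A rule: infinite_finite_induct)
    case (insert i A)
    have "sum g A \<in> S2" using insert by (intro v2.subspace_sum[OF S(2)]) auto
    then have "\<beta> x (g i + sum g A) = \<beta> x (g i) + \<beta> x (sum g A)"
      using \<beta> that(1) insert.prems unfolding bilinear_on_def by blast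
    then show ?case using insert by simp
  qed (use \<beta>0r that in auto)
  have \<beta>sl: "\<beta> (sum g A) y = (\<Sum>i\<in>A. \<beta> (g i) y)" if "y \<in> S2" "\<And>i. i \<in> A \<Longrightarrow> g i \<in> S1"
    for y and g :: "nat \<Rightarrow> 'v" and A
    using that(2)
  proof (induction A rule: infinite_finite_induct)
    case (insert i A)
    have "sum g A \<in> S1" using insert by (intro v1.subspace_sum[OF S(1)]) auto
    then have "\<beta> (g i + sum g A) y = \<beta> (g i) y + \<beta> (sum g A) y"
      using \<beta> that(1) insert.prems unfolding bilinear_on_def by blast
    then show ?case using insert by simp
  qed (use \<beta>0l that in auto)
  have \<beta>scr: "\<beta> x (s2 k y) = \<beta> (s1 k x) y" if "x \<in> S1" "y \<in> S2" for k x y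
    using \<beta> that unfolding bilinear_on_def by metis
  have main: "(\<Sum>i<l. \<beta> (x i) (y i)) = (\<Sum>e\<in>B. \<beta> (\<Sum>i<l. s1 (r (y i) e) (x i)) e)"
    if xy: "\<And>i. i < l \<Longrightarrow> x i \<in> S1 \<and> y i \<in> ?G" for l :: nat and x y
  proof -
    have "\<beta> (x i) (y i) = (\<Sum>e\<in>B. \<beta> (s1 (r (y i) e) (x i)) e)" if "i < l" for i
    proof -
      have "\<beta> (x i) (y i) = \<beta> (x i) (\<Sum>e\<in>B. s2 (r (y i) e) e)" using expand xy that by simp
      also have "\<dots> = (\<Sum>e\<in>B. \<beta> (x i) (s2 (r (y i) e) e))"
        by (rule \<beta>sr) (use xy that BS in \<open>auto intro: v2.subspace_scale[OF S(2)]\<close>)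
      also have "\<dots> = (\<Sum>e\<in>B. \<beta> (s1 (r (y i) e) (x i)) e)"
        by (rule sum.cong[OF refl], rule \<beta>scr) (use xy that BS in auto)
      finally show ?thesis .
    qed
    then have "(\<Sum>i<l. \<beta> (x i) (y i)) = (\<Sum>i<l. \<Sum>e\<in>B. \<beta> (s1 (r (y i) e) (x i)) e)" by simp
    also have "\<dots> = (\<Sum>e\<in>B. \<Sum>i<l. \<beta> (s1 (r (y i) e) (x i)) e)" by (rule sum.swap)
    also have "\<dots> = (\<Sum>e\<in>B. \<beta> (\<Sum>i<l. s1 (r (y i) e) (x i)) e)"
      by (rule sum.cong[OF refl], rule \<beta>sl[symmetric])
        (use xy BS in \<open>auto intro: v1.subspace_scale[OF S(1)]\<close>)
    finally show ?thesis .
  qed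
  have coeff: "(\<Sum>i<n. s1 (r (b i) e) (a i)) = (\<Sum>i<m. s1 (r (d i) e) (c i))" if e: "e \<in> B" for e
  proof (rule functional_separates[OF V(1)])
    fix \<phi> assume \<phi>: "Vector_Spaces.linear s1 (*) \<phi>"
    obtain \<psi> where \<psi>: "Vector_Spaces.linear s2 (*) \<psi>" "\<forall>x\<in>B. \<psi> x = (if x = e then 1 else 0)"
      using p.linear_independent_extend[OF B(2), of "\<lambda>x. if x = e then 1 else 0"] by blast
    have \<psi>r: "\<psi> y = r y e" if "y \<in> ?G" for y
    proof -
      have "\<psi> y = \<psi> (\<Sum>e\<in>B. s2 (r y e) e)" using expand[OF that] by simp
      also have "\<dots> = (\<Sum>x\<in>B. r y x * \<psi> x)" by (simp add: linear_functionalD[OF \<psi>(1)])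
      also have "\<dots> = (\<Sum>x\<in>B. if x = e then r y e else 0)"
        using \<psi>(2) by (intro sum.cong) auto
      finally show ?thesis using e finB by simp
    qed
    have "(\<Sum>i<n. \<phi> (a i) * \<psi> (b i)) = (\<Sum>i<m. \<phi> (c i) * \<psi> (d i))"
      using fun_cong[OF fun_cong[OF eq, of \<phi>], of \<psi>] \<phi> \<psi>(1) by (simp add: sum_fun_apply2 tens_def)
    then show "\<phi> (\<Sum>i<n. s1 (r (b i) e) (a i)) = \<phi> (\<Sum>i<m. s1 (r (d i) e) (c i))"
      by (simp add: linear_functionalD[OF \<phi>] \<psi>r mult.commute)
  qed
  show ?thesis using main[of n a b] main[of m c d] ab cd coeff by simp
qed

lemma tensor_lift_eq:
  assumes "vector_space s1" "vector_space s2" "vector_space s3"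
    and "module.subspace s1 S1" "module.subspace s2 S2"
    and "bilinear_on s1 S1 s2 S2 s3 \<beta>"
    and "\<And>i. i < (n::nat) \<Longrightarrow> a i \<in> S1 \<and> b i \<in> S2"
  shows "tensor_lift s1 S1 s2 S2 \<beta> (\<Sum>i<n. tens s1 s2 (a i) (b i)) = (\<Sum>i<n. \<beta> (a i) (b i))"
  unfolding tensor_lift_def
proof (rule the_equality)
  show "\<exists>(n'::nat) a' b'. (\<forall>i<n'. a' i \<in> S1 \<and> b' i \<in> S2) \<and>
      (\<Sum>i<n. tens s1 s2 (a i) (b i)) = (\<Sum>i<n'. tens s1 s2 (a' i) (b' i)) \<and>
      (\<Sum>i<n. \<beta> (a i) (b i)) = (\<Sum>i<n'. \<beta> (a' i) (b' i))"
    using assms(7) by blast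
next
  fix x
  assume "\<exists>(n'::nat) a' b'. (\<forall>i<n'. a' i \<in> S1 \<and> b' i \<in> S2) \<and>
      (\<Sum>i<n. tens s1 s2 (a i) (b i)) = (\<Sum>i<n'. tens s1 s2 (a' i) (b' i)) \<and>
      x = (\<Sum>i<n'. \<beta> (a' i) (b' i))"
  then obtain n' :: nat and a' b' where
    *: "\<forall>i<n'. a' i \<in> S1 \<and> b' i \<in> S2"
       "(\<Sum>i<n. tens s1 s2 (a i) (b i)) = (\<Sum>i<n'. tens s1 s2 (a' i) (b' i))"
       "x = (\<Sum>i<n'. \<beta> (a' i) (b' i))"
    by blast
  have "(\<Sum>i<n. \<beta> (a i) (b i)) = (\<Sum>i<n'. \<beta> (a' i) (b' i))"
    by (rule tens_sum_unique[OF assms(1-6) _ _ *(2)]) (use assms(7) *(1) in auto)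
  then show "x = (\<Sum>i<n. \<beta> (a i) (b i))" using *(3) by simp
qed

lemma tensor_lift_tens:
  assumes "vector_space s1" "vector_space s2" "vector_space s3"
    and "module.subspace s1 S1" "module.subspace s2 S2"
    and "bilinear_on s1 S1 s2 S2 s3 \<beta>" and "a \<in> S1" "b \<in> S2"
  shows "tensor_lift s1 S1 s2 S2 \<beta> (tens s1 s2 a b) = \<beta> a b"
  using tensor_lift_eq[OF assms(1-6), of 1 "\<lambda>_. a" "\<lambda>_. b"] assms(7,8) by simp

lemma subspace_tensor_prod:
  assumes "vector_space s1" "vector_space s2" "module.subspace s1 S1" "module.subspace s2 S2"
  shows "module.subspace tscale (tensor_prod s1 S1 s2 S2)"
proof -
  interpret v1: vector_space s1 by fact
  interpret t: vector_space tscale by (rule vector_space_tscale)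
  let ?T = "tensor_prod s1 S1 s2 S2"
  show ?thesis
  proof (rule t.subspaceI)
    have "0 = (\<Sum>i<0::nat. tens s1 s2 (undefined i) (undefined i))" by simp
    then show "0 \<in> ?T" unfolding tensor_prod_def by blast
  next
    fix t u assume "t \<in> ?T" "u \<in> ?T"
    then obtain n a b m c d where
      t: "\<forall>i<n::nat. a i \<in> S1 \<and> b i \<in> S2" "t = (\<Sum>i<n. tens s1 s2 (a i) (b i))" and
      u: "\<forall>i<m::nat. c i \<in> S1 \<and> d i \<in> S2" "u = (\<Sum>i<m. tens s1 s2 (c i) (d i))"
      unfolding tensor_prod_def by blast
    let ?e = "\<lambda>i. if i < n then a i else c (i - n)" and ?f = "\<lambda>i. if i < n then b i else d (i - n)"
    have "(\<Sum>i<n+m. tens s1 s2 (?e i) (?f i)) =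
        (\<Sum>i<n. tens s1 s2 (?e i) (?f i)) + (\<Sum>i<m. tens s1 s2 (?e (n + i)) (?f (n + i)))"
      by (induction m) (simp_all add: add.assoc)
    then have "t + u = (\<Sum>i<n+m. tens s1 s2 (?e i) (?f i))" using t u by simp
    moreover have "\<forall>i<n+m. ?e i \<in> S1 \<and> ?f i \<in> S2"
    proof (intro allI impI)
      fix i assume "i < n + m"
      then show "?e i \<in> S1 \<and> ?f i \<in> S2" using t(1) u(1) by (cases "i < n") auto
    qed
    ultimately show "t + u \<in> ?T"
      unfolding tensor_prod_def
      by (intro CollectI exI[of _ "n + m"] exI[of _ ?e] exI[of _ ?f]) blast
  next
    fix c t assume "t \<in> ?T"
    then obtain n a b where
      t: "\<forall>i<n::nat. a i \<in> S1 \<and> b i \<in> S2" "t = (\<Sum>i<n. tens s1 s2 (a i) (b i))"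
      unfolding tensor_prod_def by blast
    have "tscale c t = (\<Sum>i<n. tens s1 s2 (s1 c (a i)) (b i))"
      using tens_bilinear[of s1 s2] by (simp add: t(2) t.scale_sum_right bilinear_on_def)
    moreover have "\<forall>i<n. s1 c (a i) \<in> S1 \<and> b i \<in> S2"
      using t(1) v1.subspace_scale[OF assms(3)] by blast
    ultimately show "tscale c t \<in> ?T"
      unfolding tensor_prod_def
      by (intro CollectI exI[of _ n] exI[of _ "\<lambda>i. s1 c (a i)"] exI[of _ b]) blast
  qed
qed


section \<open>Lie algebras and Lie bialgebras\<close>

definition lie_algebra ::
  "('k::field \<Rightarrow> 'r::ab_group_add \<Rightarrow> 'r) \<Rightarrow> ('r \<Rightarrow> 'r \<Rightarrow> 'r) \<Rightarrow> bool"
  where "lie_algebra scale br \<longleftrightarrow>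
    vector_space scale \<and> bilinear_on scale UNIV scale UNIV scale br \<and>
    (\<forall>x. br x x = 0) \<and>
    (\<forall>x y z. br x (br y z) + br y (br z x) + br z (br x y) = 0)"

definition lie_subalgebra ::
  "('k::field \<Rightarrow> 'r::ab_group_add \<Rightarrow> 'r) \<Rightarrow> ('r \<Rightarrow> 'r \<Rightarrow> 'r) \<Rightarrow> 'r set \<Rightarrow> bool"
  where "lie_subalgebra scale br S \<longleftrightarrow> module.subspace scale S \<and> (\<forall>x\<in>S. \<forall>y\<in>S. br x y \<in> S)"

text \<open>
  The constants of the following context take the scalar multiplication and, where it is used, the Lie
  bracket of the ambient Lie algebra as explicit arguments. The operations on tensors are defined on
  all tensors of the ambient space; for a Lie subalgebra \<open>S\<close> they restrict to those of \<open>S\<close>. Only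
  \<open>\<delta> \<otimes> 1\<close> refers to \<open>S\<close>, because \<open>\<delta>\<close> is a map on \<open>S\<close> (its values elsewhere are irrelevant).
  Here \<open>cobracket_id S \<delta>\<close> is \<open>\<delta> \<otimes> 1\<close>, \<open>inner_cobracket t\<close> is \<open>\<partial>\<^sub>t\<close>, and \<open>cyb t\<close> is \<open>[[t, t]]\<close>, with summands
  \<open>[t\<^sup>1\<^sup>2, t\<^sup>1\<^sup>3]\<close>, \<open>[t\<^sup>1\<^sup>2, t\<^sup>2\<^sup>3]\<close>, \<open>[t\<^sup>1\<^sup>3, t\<^sup>2\<^sup>3]\<close> in this order.
\<close>

context
  fixes scale :: "'k::field \<Rightarrow> 'r::ab_group_add \<Rightarrow> 'r"
    and br :: "'r \<Rightarrow> 'r \<Rightarrow> 'r"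
begin

definition tens2 :: "'r \<Rightarrow> 'r \<Rightarrow> ('k, 'r) tensor2" (infixl \<open>\<otimes>\<close> 70)
  where "a \<otimes> b = tens scale scale a b"

definition tens3 :: "('k, 'r) tensor2 \<Rightarrow> 'r \<Rightarrow> ('k, 'r) tensor3" (infixl \<open>\<otimes>\<otimes>\<close> 70)
  where "t \<otimes>\<otimes> c = tens tscale scale t c"

definition lift2 :: "('r \<Rightarrow> 'r \<Rightarrow> 'u::comm_monoid_add) \<Rightarrow> ('k, 'r) tensor2 \<Rightarrow> 'u"
  where "lift2 \<beta> t = tensor_lift scale UNIV scale UNIV \<beta> t"

definition lift3 :: "('r \<Rightarrow> 'r \<Rightarrow> 'r \<Rightarrow> 'u::comm_monoid_add) \<Rightarrow> ('k, 'r) tensor3 \<Rightarrow> 'u"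
  where "lift3 \<gamma> T =
    tensor_lift tscale (tensor_prod scale UNIV scale UNIV) scale UNIV
      (\<lambda>t c. lift2 (\<lambda>a b. \<gamma> a b c) t) T"

definition wedge2 :: "'r set \<Rightarrow> ('k, 'r) tensor2 set"
  where "wedge2 S = {t \<in> tensor_prod scale S scale S. lift2 (\<lambda>a b. b \<otimes> a) t = - t}"

definition diag_action :: "'r \<Rightarrow> ('k, 'r) tensor2 \<Rightarrow> ('k, 'r) tensor2"
  where "diag_action a t = lift2 (\<lambda>b c. br a b \<otimes> c + b \<otimes> br a c) t"

definition inner_cobracket :: "('k, 'r) tensor2 \<Rightarrow> 'r \<Rightarrow> ('k, 'r) tensor2"
  where "inner_cobracket t a = diag_action a t"

definition alt :: "('k, 'r) tensor3 \<Rightarrow> ('k, 'r) tensor3"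
  where "alt T = lift3 (\<lambda>a b c. a \<otimes> b \<otimes>\<otimes> c + c \<otimes> a \<otimes>\<otimes> b + b \<otimes> c \<otimes>\<otimes> a) T"

definition cyb :: "('k, 'r) tensor2 \<Rightarrow> ('k, 'r) tensor3"
  where "cyb t =
    lift2 (\<lambda>a b. lift2 (\<lambda>c d.
      br a c \<otimes> b \<otimes>\<otimes> d + a \<otimes> br b c \<otimes>\<otimes> d + a \<otimes> c \<otimes>\<otimes> br b d) t) t"

definition cobracket_id ::
  "'r set \<Rightarrow> ('r \<Rightarrow> ('k, 'r) tensor2) \<Rightarrow> ('k, 'r) tensor2 \<Rightarrow> ('k, 'r) tensor3"
  where "cobracket_id S \<delta> t = tensor_lift scale S scale S (\<lambda>a b. \<delta> a \<otimes>\<otimes> b) t"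

definition lie_bialgebra :: "'r set \<Rightarrow> ('r \<Rightarrow> ('k, 'r) tensor2) \<Rightarrow> bool"
  where "lie_bialgebra S \<delta> \<longleftrightarrow>
    lie_algebra scale br \<and> lie_subalgebra scale br S \<and>
    (\<forall>a\<in>S. \<forall>b\<in>S. \<delta> (a + b) = \<delta> a + \<delta> b) \<and>
    (\<forall>c. \<forall>a\<in>S. \<delta> (scale c a) = tscale c (\<delta> a)) \<and>
    (\<forall>a\<in>S. \<delta> a \<in> wedge2 S) \<and>
    (\<forall>a\<in>S. \<forall>b\<in>S. \<delta> (br a b) = diag_action a (\<delta> b) - diag_action b (\<delta> a)) \<and>
    (\<forall>a\<in>S. alt (cobracket_id S \<delta> (\<delta> a)) = 0)"


section \<open>Commensurability and Manin triples\<close>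

definition coset :: "'r set \<Rightarrow> 'r \<Rightarrow> 'r set"
  where "coset N u = {u + x | x. x \<in> N}"

text \<open>The quotient \<open>U / N\<close> is finite dimensional: it is spanned by finitely many cosets.\<close>

definition finite_dim_quotient :: "'r set \<Rightarrow> 'r set \<Rightarrow> bool"
  where "finite_dim_quotient U N \<longleftrightarrow>
    (\<exists>B. finite B \<and> B \<subseteq> U \<and> (\<forall>u\<in>U. \<exists>c. coset N u = coset N (\<Sum>b\<in>B. scale (c b) b)))"

definition commensurable :: "'r set \<Rightarrow> 'r set \<Rightarrow> bool"
  where "commensurable W' W'' \<longleftrightarrow> finite_dim_quotient {x + y | x y. x \<in> W' \<and> y \<in> W''} (W' \<inter> W'')"

definition perp :: "('r \<Rightarrow> 'r \<Rightarrow> 'k) \<Rightarrow> 'r set \<Rightarrow> 'r set"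
  where "perp F S = {x. \<forall>y\<in>S. F x y = 0}"

definition manin_triple :: "('r \<Rightarrow> 'r \<Rightarrow> 'k) \<Rightarrow> 'r set \<Rightarrow> 'r set \<Rightarrow> bool"
  where "manin_triple F Rp Rm \<longleftrightarrow>
    lie_algebra scale br \<and>
    bilinear_on scale UNIV scale UNIV (*) F \<and>
    (\<forall>x y. F x y = F y x) \<and>
    (\<forall>x y z. F (br x y) z = F x (br y z)) \<and>
    (\<forall>x. (\<forall>y. F x y = 0) \<longrightarrow> x = 0) \<and>
    lie_subalgebra scale br Rp \<and> lie_subalgebra scale br Rm \<and>
    {x + y | x y. x \<in> Rp \<and> y \<in> Rm} = UNIV \<and> Rp \<inter> Rm = {0} \<and>
    Rp \<subseteq> perp F Rp \<and> Rm \<subseteq> perp F Rm"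

definition form2 :: "('r \<Rightarrow> 'r \<Rightarrow> 'k) \<Rightarrow> ('k, 'r) tensor2 \<Rightarrow> ('k, 'r) tensor2 \<Rightarrow> 'k"
  where "form2 F t u = lift2 (\<lambda>a1 a2. lift2 (\<lambda>b1 b2. F a1 b1 * F a2 b2) u) t"

definition determines_cobracket ::
  "('r \<Rightarrow> 'r \<Rightarrow> 'k) \<Rightarrow> 'r set \<Rightarrow> 'r set \<Rightarrow> ('r \<Rightarrow> ('k, 'r) tensor2) \<Rightarrow> bool"
  where "determines_cobracket F Rp Rm \<delta> \<longleftrightarrow>
    manin_triple F Rp Rm \<and> lie_bialgebra Rp \<delta> \<and>
    (\<forall>a\<in>Rp. \<forall>b1\<in>Rm. \<forall>b2\<in>Rm. form2 F (\<delta> a) (b1 \<otimes> b2) = F a (br b1 b2))"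

definition MT :: "('r \<Rightarrow> 'r \<Rightarrow> 'k) \<Rightarrow> 'r set \<Rightarrow> 'r set \<Rightarrow> 'r set set"
  where "MT F Rp Rm = {W. manin_triple F Rp W \<and> commensurable W Rm}"

definition twist_map :: "('r \<Rightarrow> 'r \<Rightarrow> 'k) \<Rightarrow> ('k, 'r) tensor2 \<Rightarrow> 'r \<Rightarrow> 'r"
  where "twist_map F t w = lift2 (\<lambda>a b. scale (F w a) b) t"

definition twisted :: "('r \<Rightarrow> 'r \<Rightarrow> 'k) \<Rightarrow> 'r set \<Rightarrow> ('k, 'r) tensor2 \<Rightarrow> 'r set"
  where "twisted F Rm t = {w + twist_map F t w | w. w \<in> Rm}"

end

end

theory Submission
  imports Defs
begin

text \<open>
  A tensor over \<open>Rp\<close> is determined by its values on the functionals \<open>\<lambda>x. F x w\<close> with \<open>w\<close> in \<open>Rm\<close>, so all identities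
  are checked there. With \<open>f\<close> the map given by a skew tensor \<open>t\<close>, the value of \<open>alt ((\<delta> \<otimes> 1) t) - [[t, t]]\<close> at
  \<open>u, v, w\<close> is \<open>- F [u + f u, v + f v] (w + f w)\<close>, and since the graph of \<open>f\<close> is Lagrangian, this vanishes
  identically iff the graph is closed under the bracket. Conversely, a Lagrangian complement \<open>W\<close> of \<open>Rp\<close> is the
  graph of a skew map \<open>f\<close> from \<open>Rm\<close> to \<open>Rp\<close>, and commensurability of \<open>W\<close> with \<open>Rm\<close> says that \<open>f\<close> has finite rank,
  that is, comes from a tensor.
\<close>

section \<open>Tensors and functionals\<close>

text \<open>In infinite dimension \<open>Rm\<close> need not be the full dual of \<open>Rp\<close>;
  isotropy and non-degeneracy only make it a separating family of functionals. For identities this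
  suffices, because a tensor is a finite sum and can be contracted one factor at a time. It does not
  suffice to turn a map from \<open>Rm\<close> to \<open>Rp\<close> into a tensor: there finite rank
  enters, and a finite independent family in \<open>Rp\<close> receives dual vectors in
  \<open>Rm\<close> by an explicit induction. A further obstacle is that brackets of
  \<open>Rp\<close> with \<open>Rm\<close> lie in neither summand; tensors over \<open>Rp\<close>
  ignore the component of an argument in \<open>Rp\<close>, which keeps evaluation at such brackets
  and at points of the graph manageable. The axioms of the twisted cobracket are not computed from
  those of \<delta>: a map dual to the bracket of the complementary subalgebra is a cobracket, and
  this is applied to the graph.\<close>

abbreviation lin :: "('k::field \<Rightarrow> 'v::ab_group_add \<Rightarrow> 'v) \<Rightarrow> ('v \<Rightarrow> 'k) \<Rightarrow> bool"
  where "lin s \<phi> \<equiv> Vector_Spaces.linear s (*) \<phi>"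

lemma lin_intro:
  assumes "vector_space s" "\<And>x y. \<phi> (x + y) = \<phi> x + \<phi> y" "\<And>c x. \<phi> (s c x) = c * \<phi> x"
  shows "lin s \<phi>"
  unfolding Vector_Spaces.linear_iff using assms vector_space_mult by blast

lemma tens_apply: "lin s1 \<phi> \<Longrightarrow> lin s2 \<psi> \<Longrightarrow> tens s1 s2 a b \<phi> \<psi> = \<phi> a * \<psi> b"
  by (simp add: tens_def)

text \<open>Allows evaluation at a pair of functionals to serve as the first argument of a threefold
  tensor, where a non-linear argument would give the default value 0.\<close>

lemma lin_eval: "lin tscale (\<lambda>t. t \<phi> \<psi>)"
  by (rule lin_intro) (auto simp: vector_space_tscale tscale_def)

lemma tscale_add: "tscale c (t + u) = tscale c t + tscale c u"
  by (simp add: tscale_def fun_eq_iff distrib_left)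

lemma tensor_prodE:
  assumes "t \<in> tensor_prod s1 S1 s2 S2"
  obtains n :: nat and a b where "\<And>i. i < n \<Longrightarrow> a i \<in> S1 \<and> b i \<in> S2"
    "t = (\<Sum>i<n. tens s1 s2 (a i) (b i))"
  using assms unfolding tensor_prod_def by blast

lemma tensor_prodI:
  "(\<And>i. i < (n::nat) \<Longrightarrow> a i \<in> S1 \<and> b i \<in> S2) \<Longrightarrow>
    (\<Sum>i<n. tens s1 s2 (a i) (b i)) \<in> tensor_prod s1 S1 s2 S2"
  unfolding tensor_prod_def by blast

lemma tens_in_tensor_prod: "a \<in> S1 \<Longrightarrow> b \<in> S2 \<Longrightarrow> tens s1 s2 a b \<in> tensor_prod s1 S1 s2 S2"
  using tensor_prodI[of 1 "\<lambda>_. a" S1 "\<lambda>_. b" S2 s1 s2] by simp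

lemma tensor_prod_mono:
  "S1 \<subseteq> T1 \<Longrightarrow> S2 \<subseteq> T2 \<Longrightarrow> tensor_prod s1 S1 s2 S2 \<subseteq> tensor_prod s1 T1 s2 T2"
  unfolding tensor_prod_def by (auto; blast)

text \<open>\<open>tensor_lift\<close> is a description over all representations of a tensor, so
  additivity is read off a representation of the sum, obtained by concatenating those of
  \<open>t\<close> and \<open>u\<close>.\<close>

lemma tensor_lift_add:
  assumes "vector_space s1" "vector_space s2" "vector_space s3"
    and "module.subspace s1 S1" "module.subspace s2 S2"
    and "bilinear_on s1 S1 s2 S2 s3 \<beta>"
    and "t \<in> tensor_prod s1 S1 s2 S2" "u \<in> tensor_prod s1 S1 s2 S2"
  shows "tensor_lift s1 S1 s2 S2 \<beta> (t + u) = tensor_lift s1 S1 s2 S2 \<beta> t + tensor_lift s1 S1 s2 S2 \<beta> u"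
proof -
  obtain n a b where t: "\<And>i. i < (n::nat) \<Longrightarrow> a i \<in> S1 \<and> b i \<in> S2"
    "t = (\<Sum>i<n. tens s1 s2 (a i) (b i))" using assms(7) by (blast elim: tensor_prodE)
  obtain m c d where u: "\<And>i. i < (m::nat) \<Longrightarrow> c i \<in> S1 \<and> d i \<in> S2"
    "u = (\<Sum>i<m. tens s1 s2 (c i) (d i))" using assms(8) by (blast elim: tensor_prodE)
  let ?e = "\<lambda>i. if i < n then a i else c (i - n)" and ?f = "\<lambda>i. if i < n then b i else d (i - n)"
  have concat: "(\<Sum>i<n+m. g (?e i) (?f i)) = (\<Sum>i<n. g (a i) (b i)) + (\<Sum>i<m. g (c i) (d i))"
    for g :: "_ \<Rightarrow> _ \<Rightarrow> 'x::ab_group_add"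
    by (induction m) (simp_all add: add.assoc)
  have "t + u = (\<Sum>i<n+m. tens s1 s2 (?e i) (?f i))" by (simp only: t u concat)
  moreover have "?e i \<in> S1 \<and> ?f i \<in> S2" if "i < n + m" for i
    using t(1) u(1) that by (cases "i < n") auto
  ultimately have "tensor_lift s1 S1 s2 S2 \<beta> (t + u) = (\<Sum>i<n+m. \<beta> (?e i) (?f i))"
    using tensor_lift_eq[OF assms(1-6), of "n + m" ?e ?f] by presburger
  then show ?thesis
    using tensor_lift_eq[OF assms(1-6) t(1)] tensor_lift_eq[OF assms(1-6) u(1)] t(2) u(2) concat
    by simp
qed

lemma tensor_lift_scale:
  assumes "vector_space s1" "vector_space s2" "vector_space s3"
    and "module.subspace s1 S1" "module.subspace s2 S2"
    and "bilinear_on s1 S1 s2 S2 s3 \<beta>" "t \<in> tensor_prod s1 S1 s2 S2"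
  shows "tensor_lift s1 S1 s2 S2 \<beta> (tscale c t) = s3 c (tensor_lift s1 S1 s2 S2 \<beta> t)"
proof -
  interpret v1: vector_space s1 by fact
  interpret v3: vector_space s3 by fact
  interpret t: vector_space tscale by (rule vector_space_tscale)
  obtain n a b where t: "\<And>i. i < (n::nat) \<Longrightarrow> a i \<in> S1 \<and> b i \<in> S2"
    "t = (\<Sum>i<n. tens s1 s2 (a i) (b i))" using assms(7) by (blast elim: tensor_prodE)
  have "tscale c t = (\<Sum>i<n. tens s1 s2 (s1 c (a i)) (b i))"
    using tens_bilinear[of s1 s2] by (simp add: t(2) t.scale_sum_right bilinear_on_def)
  moreover have "s1 c (a i) \<in> S1 \<and> b i \<in> S2" if "i < n" for i
    using t(1)[OF that] v1.subspace_scale[OF assms(4)] by blast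
  ultimately have "tensor_lift s1 S1 s2 S2 \<beta> (tscale c t) = (\<Sum>i<n. \<beta> (s1 c (a i)) (b i))"
    using tensor_lift_eq[OF assms(1-6), of n "\<lambda>i. s1 c (a i)" b] by presburger
  also have "\<dots> = (\<Sum>i<n. s3 c (\<beta> (a i) (b i)))"
    using assms(6) t(1) unfolding bilinear_on_def by (intro sum.cong) auto
  finally show ?thesis
    using tensor_lift_eq[OF assms(1-6) t(1)] t(2) by (simp add: v3.scale_sum_right)
qed

text \<open>Contracting the second factor with \<open>h\<close> leaves a vector of
  \<open>S1\<close>, which vanishes because \<open>G1\<close> separates \<open>S1\<close>;
  contracting the first factor with any functional then leaves a vector of \<open>S2\<close>. The
  families separate the two subspaces only, not the ambient spaces.\<close>

lemma tensor_prod_separated: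
  assumes V: "vector_space s1" "vector_space s2"
    and S: "module.subspace s1 S1" "module.subspace s2 S2"
    and G: "\<And>g. g \<in> G1 \<Longrightarrow> lin s1 g" "\<And>g. g \<in> G2 \<Longrightarrow> lin s2 g"
    and sep: "\<And>x. x \<in> S1 \<Longrightarrow> (\<And>g. g \<in> G1 \<Longrightarrow> g x = 0) \<Longrightarrow> x = 0"
      "\<And>x. x \<in> S2 \<Longrightarrow> (\<And>g. g \<in> G2 \<Longrightarrow> g x = 0) \<Longrightarrow> x = 0"
    and t: "t \<in> tensor_prod s1 S1 s2 S2" "\<And>g h. g \<in> G1 \<Longrightarrow> h \<in> G2 \<Longrightarrow> t g h = 0"
  shows "t = 0"
proof -
  interpret v1: vector_space s1 by fact
  interpret v2: vector_space s2 by fact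
  obtain n a b where ab: "\<And>i. i < (n::nat) \<Longrightarrow> a i \<in> S1 \<and> b i \<in> S2"
    and t_eq: "t = (\<Sum>i<n. tens s1 s2 (a i) (b i))" using t(1) by (blast elim: tensor_prodE)
  have t_apply: "t \<phi> \<psi> = (\<Sum>i<n. \<phi> (a i) * \<psi> (b i))" if "lin s1 \<phi>" "lin s2 \<psi>" for \<phi> \<psi>
    by (simp add: t_eq sum_fun_apply2 tens_apply that)
  have left: "t \<phi> h = 0" if "lin s1 \<phi>" "h \<in> G2" for \<phi> h
  proof -
    have "(\<Sum>i<n. s1 (h (b i)) (a i)) = 0"
    proof (rule sep(1))
      show "(\<Sum>i<n. s1 (h (b i)) (a i)) \<in> S1"
        using ab by (auto intro: v1.subspace_sum[OF S(1)] v1.subspace_scale[OF S(1)])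
      show "g (\<Sum>i<n. s1 (h (b i)) (a i)) = 0" if "g \<in> G1" for g
        using t(2)[OF that \<open>h \<in> G2\<close>] t_apply[OF G(1)[OF that] G(2)[OF \<open>h \<in> G2\<close>]]
        by (simp add: linear_functionalD[OF G(1)[OF that]] mult.commute)
    qed
    then have "\<phi> (\<Sum>i<n. s1 (h (b i)) (a i)) = 0" by (simp add: linear_functionalD[OF that(1)])
    then show ?thesis
      by (simp add: t_apply[OF that(1) G(2)[OF that(2)]] linear_functionalD[OF that(1)] mult.commute)
  qed
  have "t \<phi> \<psi> = 0" if "lin s1 \<phi>" "lin s2 \<psi>" for \<phi> \<psi>
  proof -
    have "(\<Sum>i<n. s2 (\<phi> (a i)) (b i)) = 0"
    proof (rule sep(2))
      show "(\<Sum>i<n. s2 (\<phi> (a i)) (b i)) \<in> S2"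
        using ab by (auto intro: v2.subspace_sum[OF S(2)] v2.subspace_scale[OF S(2)])
      show "h (\<Sum>i<n. s2 (\<phi> (a i)) (b i)) = 0" if "h \<in> G2" for h
        using left[OF \<open>lin s1 \<phi>\<close> that] t_apply[OF \<open>lin s1 \<phi>\<close> G(2)[OF that]]
        by (simp add: linear_functionalD[OF G(2)[OF that]])
    qed
    then have "\<psi> (\<Sum>i<n. s2 (\<phi> (a i)) (b i)) = 0" by (simp add: linear_functionalD[OF that(2)])
    then show ?thesis by (simp add: t_apply[OF that] linear_functionalD[OF that(2)])
  qed
  \<comment> \<open>Off the linear functionals every pure tensor has the default value 0, so
    equality as functions holds there as well.\<close>
  moreover have "t \<phi> \<psi> = 0" if "\<not> (lin s1 \<phi> \<and> lin s2 \<psi>)" for \<phi> \<psi>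
    using that by (auto simp: t_eq sum_fun_apply2 tens_def)
  ultimately show ?thesis by (fastforce simp: fun_eq_iff)
qed

section \<open>Lifts of multilinear maps\<close>

locale tensor_space = vector_space scale
  for scale :: "'k::field \<Rightarrow> 'v::ab_group_add \<Rightarrow> 'v"
begin

abbreviation T2 where "T2 S \<equiv> tensor_prod scale S scale S"
abbreviation T3 where "T3 S \<equiv> tensor_prod tscale (T2 S) scale S"

lemma subspace_T2: "subspace S \<Longrightarrow> module.subspace tscale (T2 S)"
  by (intro subspace_tensor_prod vector_space_axioms)

lemma subspace_T3: "subspace S \<Longrightarrow> module.subspace tscale (T3 S)"
  by (intro subspace_tensor_prod vector_space_axioms vector_space_tscale subspace_T2)

lemma T2_UNIV: "t \<in> T2 S \<Longrightarrow> t \<in> T2 UNIV"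
  using tensor_prod_mono[of S UNIV S UNIV] by blast

lemma T3_UNIV: "t \<in> T3 S \<Longrightarrow> t \<in> T3 UNIV"
  using tensor_prod_mono[of "T2 S" "T2 UNIV" S UNIV] T2_UNIV by blast

lemma tens2_in_T2: "a \<in> S \<Longrightarrow> b \<in> S \<Longrightarrow> tens2 scale a b \<in> T2 S"
  unfolding tens2_def by (rule tens_in_tensor_prod)

lemma tens3_in_T3: "u \<in> T2 S \<Longrightarrow> b \<in> S \<Longrightarrow> tens3 scale u b \<in> T3 S"
  unfolding tens3_def by (rule tens_in_tensor_prod)

lemma lift2_eq:
  assumes "vector_space s3" "bilinear_on scale UNIV scale UNIV s3 \<beta>"
  shows "lift2 scale \<beta> (\<Sum>i<n. tens scale scale (a i) (b i)) = (\<Sum>i<(n::nat). \<beta> (a i) (b i))"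
  unfolding lift2_def
  by (rule tensor_lift_eq[OF vector_space_axioms vector_space_axioms assms(1) _ _ assms(2)]) auto

lemma lift2_add:
  assumes "vector_space s3" "bilinear_on scale UNIV scale UNIV s3 \<beta>" "t \<in> T2 UNIV" "u \<in> T2 UNIV"
  shows "lift2 scale \<beta> (t + u) = lift2 scale \<beta> t + lift2 scale \<beta> u"
  unfolding lift2_def
  by (rule tensor_lift_add[OF vector_space_axioms vector_space_axioms assms(1) _ _ assms(2-)]) auto

lemma lift2_scale:
  assumes "vector_space s3" "bilinear_on scale UNIV scale UNIV s3 \<beta>" "t \<in> T2 UNIV"
  shows "lift2 scale \<beta> (tscale c t) = s3 c (lift2 scale \<beta> t)"
  unfolding lift2_def
  by (rule tensor_lift_scale[OF vector_space_axioms vector_space_axioms assms(1) _ _ assms(2-)]) auto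

lemmas tens2_lin = tens_bilinear[of scale scale, unfolded bilinear_on_def, folded tens2_def, simplified]

lemma tens3_lin:
  "tens3 scale (t + u) c = tens3 scale t c + tens3 scale u c"
  "tens3 scale t (c + d) = tens3 scale t c + tens3 scale t d"
  "tens3 scale (tscale k t) c = tscale k (tens3 scale t c)"
  "tens3 scale t (scale k c) = tscale k (tens3 scale t c)"
  using tens_bilinear[of tscale scale] unfolding tens3_def bilinear_on_def by blast+

lemma tens2_apply: "lin scale \<phi> \<Longrightarrow> lin scale \<psi> \<Longrightarrow> tens2 scale a b \<phi> \<psi> = \<phi> a * \<psi> b"
  unfolding tens2_def by (rule tens_apply)

lemma tens3_apply: "lin scale \<chi> \<Longrightarrow> tens3 scale u c (\<lambda>t. t \<phi> \<psi>) \<chi> = u \<phi> \<psi> * \<chi> c"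
  unfolding tens3_def by (simp add: tens_apply lin_eval)

lemma swap_apply:
  assumes "t \<in> T2 UNIV" "lin scale \<phi>" "lin scale \<psi>"
  shows "lift2 scale (\<lambda>a b. tens2 scale b a) t \<phi> \<psi> = t \<psi> \<phi>"
proof -
  obtain n a b where t: "t = (\<Sum>i<(n::nat). tens scale scale (a i) (b i))"
    using assms(1) by (blast elim: tensor_prodE)
  have "bilinear_on scale UNIV scale UNIV tscale (\<lambda>a b. tens2 scale b a)"
    unfolding bilinear_on_def by (auto simp: tens2_lin)
  then show ?thesis
    by (simp add: t lift2_eq[OF vector_space_tscale] sum_fun_apply2 tens2_apply tens_apply assms mult.commute)
qed

lemma swap_in_T2:
  assumes "subspace S" "t \<in> T2 S"
  shows "lift2 scale (\<lambda>a b. tens2 scale b a) t \<in> T2 S"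
proof -
  obtain n a b where ab: "\<And>i. i < (n::nat) \<Longrightarrow> a i \<in> S \<and> b i \<in> S"
    and t: "t = (\<Sum>i<n. tens scale scale (a i) (b i))"
    using assms(2) by (blast elim: tensor_prodE)
  have "bilinear_on scale UNIV scale UNIV tscale (\<lambda>a b. tens2 scale b a)"
    unfolding bilinear_on_def by (auto simp: tens2_lin)
  then have "lift2 scale (\<lambda>a b. tens2 scale b a) t = (\<Sum>i<n. tens scale scale (b i) (a i))"
    by (simp add: t lift2_eq[OF vector_space_tscale] tens2_def)
  then show ?thesis using ab by (auto intro: tensor_prodI)
qed

section \<open>Cyclic alternation of threefold tensors\<close>

definition rot :: "'v \<Rightarrow> 'v \<Rightarrow> 'v \<Rightarrow> ('k, 'v) tensor3" where
  "rot a b c = tens3 scale (tens2 scale a b) c + tens3 scale (tens2 scale c a) b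
     + tens3 scale (tens2 scale b c) a"

lemma rot_bilinear: "bilinear_on scale UNIV scale UNIV tscale (\<lambda>a b. rot a b c)"
  unfolding bilinear_on_def rot_def
  by (auto simp: tens2_lin tens3_lin tscale_add ac_simps)

lemma lift_rot_apply:
  assumes "u \<in> T2 UNIV" "lin scale \<phi>" "lin scale \<psi>" "lin scale \<chi>"
  shows "lift2 scale (\<lambda>a b. rot a b c) u (\<lambda>t. t \<phi> \<psi>) \<chi> =
    u \<phi> \<psi> * \<chi> c + u \<psi> \<chi> * \<phi> c + u \<chi> \<phi> * \<psi> c"
proof -
  obtain n a b where u: "u = (\<Sum>i<(n::nat). tens scale scale (a i) (b i))"
    using assms(1) by (blast elim: tensor_prodE)
  have "lift2 scale (\<lambda>a b. rot a b c) u (\<lambda>t. t \<phi> \<psi>) \<chi>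
    = (\<Sum>i<n. \<phi> (a i) * \<psi> (b i) * \<chi> c + \<phi> c * \<psi> (a i) * \<chi> (b i) + \<phi> (b i) * \<psi> c * \<chi> (a i))"
    unfolding u lift2_eq[OF vector_space_tscale rot_bilinear]
    by (simp add: sum_fun_apply2 rot_def tens3_apply tens2_apply assms)
  also have "\<dots> = u \<phi> \<psi> * \<chi> c + u \<psi> \<chi> * \<phi> c + u \<chi> \<phi> * \<psi> c"
    by (simp add: u sum_fun_apply2 tens_apply assms sum.distrib sum_distrib_left sum_distrib_right
        mult_ac)
  finally show ?thesis .
qed

lemma lift_rot_in_T3:
  assumes "subspace S" "u \<in> T2 S" "c \<in> S"
  shows "lift2 scale (\<lambda>a b. rot a b c) u \<in> T3 S"
proof -
  interpret t: vector_space "tscale :: 'k \<Rightarrow> ('k, 'v) tensor3 \<Rightarrow> _" by (rule vector_space_tscale)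
  obtain n a b where ab: "\<And>i. i < (n::nat) \<Longrightarrow> a i \<in> S \<and> b i \<in> S"
    and u: "u = (\<Sum>i<n. tens scale scale (a i) (b i))"
    using assms(2) by (blast elim: tensor_prodE)
  note s = subspace_T3[OF assms(1)]
  show ?thesis unfolding u lift2_eq[OF vector_space_tscale rot_bilinear] unfolding rot_def
    using ab assms(3) by (intro t.subspace_sum[OF s] t.subspace_add[OF s] tens3_in_T3 tens2_in_T2) auto
qed

text \<open>This is the outer map of the iterated lift in \<open>alt\<close>. The inner lift is
  unspecified on functions that are not finite sums of pure tensors, hence the restriction to
  \<open>T2 UNIV\<close>.\<close>

lemma alt_lift_bilinear:
  "bilinear_on tscale (T2 UNIV) scale UNIV tscale (\<lambda>u c. lift2 scale (\<lambda>a b. rot a b c) u)"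
proof -
  have add: "lift2 scale (\<lambda>a b. rot a b (c + c')) u
      = lift2 scale (\<lambda>a b. rot a b c) u + lift2 scale (\<lambda>a b. rot a b c') u"
    and sc: "lift2 scale (\<lambda>a b. rot a b (scale k c)) u = tscale k (lift2 scale (\<lambda>a b. rot a b c) u)"
    if u: "u \<in> T2 UNIV" for u c c' k
  proof -
    interpret t: vector_space "tscale :: 'k \<Rightarrow> ('k, 'v) tensor3 \<Rightarrow> _" by (rule vector_space_tscale)
    obtain n a b where u: "u = (\<Sum>i<(n::nat). tens scale scale (a i) (b i))"
      using u by (blast elim: tensor_prodE)
    have rot: "rot a b (c + c') = rot a b c + rot a b c'" "rot a b (scale k c) = tscale k (rot a b c)" for a b
      unfolding rot_def by (auto simp: tens2_lin tens3_lin tscale_add ac_simps)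
    show "lift2 scale (\<lambda>a b. rot a b (c + c')) u
      = lift2 scale (\<lambda>a b. rot a b c) u + lift2 scale (\<lambda>a b. rot a b c') u"
      and "lift2 scale (\<lambda>a b. rot a b (scale k c)) u = tscale k (lift2 scale (\<lambda>a b. rot a b c) u)"
      unfolding u lift2_eq[OF vector_space_tscale rot_bilinear]
      by (simp_all add: rot sum.distrib t.scale_sum_right)
  qed
  show ?thesis
    unfolding bilinear_on_def
    by (auto simp: add sc lift2_add[OF vector_space_tscale rot_bilinear]
        lift2_scale[OF vector_space_tscale rot_bilinear])
qed

lemma alt_eq:
  assumes "\<And>i. i < n \<Longrightarrow> u i \<in> T2 UNIV"
  shows "alt scale (\<Sum>i<(n::nat). tens tscale scale (u i) (c i)) =
    (\<Sum>i<n. lift2 scale (\<lambda>a b. rot a b (c i)) (u i))"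
  unfolding alt_def lift3_def rot_def[symmetric]
  using assms by (intro tensor_lift_eq[OF vector_space_tscale vector_space_axioms vector_space_tscale
        subspace_T2[OF subspace_UNIV] subspace_UNIV alt_lift_bilinear]) auto

text \<open>A cyclic permutation of the factors of a pure tensor amounts to a cyclic permutation of
  the functionals, so all three summands are values of \<open>T\<close> itself.\<close>

lemma alt_apply:
  assumes "T \<in> T3 UNIV" "lin scale \<phi>" "lin scale \<psi>" "lin scale \<chi>"
  shows "alt scale T (\<lambda>t. t \<phi> \<psi>) \<chi> =
    T (\<lambda>t. t \<phi> \<psi>) \<chi> + T (\<lambda>t. t \<psi> \<chi>) \<phi> + T (\<lambda>t. t \<chi> \<phi>) \<psi>"
proof -
  obtain n u c where u: "\<And>i. i < (n::nat) \<Longrightarrow> u i \<in> T2 UNIV \<and> c i \<in> UNIV"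
    and T: "T = (\<Sum>i<n. tens tscale scale (u i) (c i))"
    using assms(1) by (blast elim: tensor_prodE)
  show ?thesis using u
    by (simp add: T alt_eq sum_fun_apply2 lift_rot_apply tens_apply lin_eval assms(2-) sum.distrib)
qed

lemma alt_in_T3:
  assumes "subspace S" "T \<in> T3 S"
  shows "alt scale T \<in> T3 S"
proof -
  interpret t: vector_space "tscale :: 'k \<Rightarrow> ('k, 'v) tensor3 \<Rightarrow> _" by (rule vector_space_tscale)
  obtain n u c where u: "\<And>i. i < (n::nat) \<Longrightarrow> u i \<in> T2 S \<and> c i \<in> S"
    and T: "T = (\<Sum>i<n. tens tscale scale (u i) (c i))"
    using assms(2) by (blast elim: tensor_prodE)
  have "alt scale T = (\<Sum>i<n. lift2 scale (\<lambda>a b. rot a b (c i)) (u i))"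
    unfolding T using u T2_UNIV by (intro alt_eq) blast
  also have "\<dots> \<in> T3 S"
    using u by (intro t.subspace_sum[OF subspace_T3] lift_rot_in_T3 assms(1)) auto
  finally show ?thesis .
qed

text \<open>\<open>\<delta>\<close> is linear on \<open>S\<close> only, so the lift is computed on
  representations with factors in \<open>S\<close>.\<close>

lemma cobracket_id_eq:
  assumes "subspace S" "\<And>a b. a \<in> S \<Longrightarrow> b \<in> S \<Longrightarrow> \<delta> (a + b) = \<delta> a + \<delta> b"
    "\<And>c a. a \<in> S \<Longrightarrow> \<delta> (scale c a) = tscale c (\<delta> a)"
    and "\<And>i. i < (n::nat) \<Longrightarrow> a i \<in> S \<and> b i \<in> S"
  shows "cobracket_id scale S \<delta> (\<Sum>i<n. tens scale scale (a i) (b i)) =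
    (\<Sum>i<n. tens tscale scale (\<delta> (a i)) (b i))"
proof -
  have "bilinear_on scale S scale S tscale (\<lambda>a b. tens3 scale (\<delta> a) b)"
    unfolding bilinear_on_def using assms(2,3) by (auto simp: tens3_lin)
  from tensor_lift_eq[OF vector_space_axioms vector_space_axioms vector_space_tscale assms(1,1) this assms(4)]
  show ?thesis unfolding cobracket_id_def tens3_def .
qed

end

section \<open>The pairing of a Manin triple\<close>

locale manin =
  fixes scale :: "'k::field \<Rightarrow> 'r::ab_group_add \<Rightarrow> 'r"
    and br :: "'r \<Rightarrow> 'r \<Rightarrow> 'r"
    and F :: "'r \<Rightarrow> 'r \<Rightarrow> 'k"
    and Rp Rm :: "'r set"
  assumes manin_triple: "manin_triple scale br F Rp Rm"
begin

sublocale tensor_space scale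
  using manin_triple unfolding manin_triple_def lie_algebra_def tensor_space_def by blast

lemma lie: "lie_algebra scale br"
  using manin_triple unfolding manin_triple_def by blast

lemma br_lin:
  "br (x + y) z = br x z + br y z" "br x (y + z) = br x y + br x z"
  "br (scale c x) y = scale c (br x y)" "br x (scale c y) = scale c (br x y)"
  using lie unfolding lie_algebra_def bilinear_on_def by blast+

lemma br_self: "br x x = 0"
  using lie unfolding lie_algebra_def by blast

lemma jacobi: "br x (br y z) + br y (br z x) + br z (br x y) = 0"
  using lie unfolding lie_algebra_def by blast

lemma br_antisym: "br y x = - br x y"
proof -
  have "br (x + y) (x + y) = 0" by (rule br_self)
  then have "br x y + br y x = 0" by (simp only: br_lin) (simp only: br_self add_0_left add_0_right add.commute)
  then show ?thesis by (rule minus_unique[symmetric])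
qed

lemma form:
  "bilinear_on scale UNIV scale UNIV (*) F"
  "\<forall>x y. F x y = F y x"
  "\<forall>x y z. F (br x y) z = F x (br y z)"
  "\<forall>x. (\<forall>y. F x y = 0) \<longrightarrow> x = 0"
  "lie_subalgebra scale br Rp" "lie_subalgebra scale br Rm"
  "{x + y | x y. x \<in> Rp \<and> y \<in> Rm} = UNIV" "Rp \<inter> Rm = {0}"
  "Rp \<subseteq> perp F Rp" "Rm \<subseteq> perp F Rm"
  using manin_triple unfolding manin_triple_def by - ((elim conjE, assumption)+)

lemma F_lin:
  "F (x + y) z = F x z + F y z" "F x (y + z) = F x y + F x z"
  "F (scale c x) y = c * F x y" "F x (scale c y) = c * F x y"
  using form unfolding bilinear_on_def by simp_all

lemma F_sym: "F x y = F y x"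
  using form(2) by simp

lemma F_inv: "F (br x y) z = F x (br y z)"
  using form(3) by blast

text \<open>Invariance and symmetry together are the cyclic symmetry of the trilinear form
  \<open>F (br x y) z\<close>.\<close>

lemma F_rot: "F (br x y) z = F y (br z x)"
  using F_inv[of z x y] by (simp add: F_sym)

lemma F_nondeg: "(\<And>y. F x y = 0) \<Longrightarrow> x = 0"
  using form(4) by blast

lemma lin_F: "lin scale (\<lambda>x. F x w)" "lin scale (F w)"
  by (auto intro!: lin_intro vector_space_axioms simp: F_lin)

lemma F_zero [simp]: "F 0 x = 0" "F x 0 = 0"
  using linear_functionalD(3)[OF lin_F(1)[of x]] linear_functionalD(3)[OF lin_F(2)[of x]] by auto

lemma F_minus: "F (- x) y = - F x y" "F x (- y) = - F x y"
  by (rule minus_unique[symmetric], simp flip: F_lin)+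

lemma F_diff: "F (x - y) z = F x z - F y z" "F x (y - z) = F x y - F x z"
  using F_lin(1)[of x "- y" z] F_lin(2)[of x y "- z"] by (simp_all add: F_minus)

lemma F_sum: "F (sum f A) y = (\<Sum>i\<in>A. F (f i) y)" "F x (sum f A) = (\<Sum>i\<in>A. F x (f i))"
  using linear_functionalD(4)[OF lin_F(1)] linear_functionalD(4)[OF lin_F(2)] by auto

lemma F_br_sum:
  "F (br (\<Sum>i<n. scale (c i) (a i)) (\<Sum>j<m. scale (d j) (b j))) w
    = (\<Sum>i<(n::nat). \<Sum>j<(m::nat). c i * d j * F (br (a i) (b j)) w)"
proof -
  have 1: "F (br (\<Sum>i<n. scale (c i) (a i)) y) w = (\<Sum>i<n. c i * F (br (a i) y) w)" for y
    by (simp add: F_inv F_sum F_lin)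
  have 2: "F (br x (\<Sum>j<m. scale (d j) (b j))) w = (\<Sum>j<m. d j * F (br x (b j)) w)" for x
    by (simp add: F_rot F_sum F_lin)
  show ?thesis unfolding 1 unfolding 2 by (simp add: sum_distrib_left mult.assoc)
qed

lemma subspaces: "subspace Rp" "subspace Rm"
  using form(5,6) unfolding lie_subalgebra_def by blast+

lemma br_closed: "x \<in> Rp \<Longrightarrow> y \<in> Rp \<Longrightarrow> br x y \<in> Rp" "x \<in> Rm \<Longrightarrow> y \<in> Rm \<Longrightarrow> br x y \<in> Rm"
  using form(5,6) unfolding lie_subalgebra_def by blast+

lemma isotropic: "x \<in> Rp \<Longrightarrow> y \<in> Rp \<Longrightarrow> F x y = 0" "x \<in> Rm \<Longrightarrow> y \<in> Rm \<Longrightarrow> F x y = 0"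
  using form(9,10) unfolding perp_def by blast+

lemma decompose: obtains p m where "p \<in> Rp" "m \<in> Rm" "x = p + m"
proof -
  have "x \<in> {x + y | x y. x \<in> Rp \<and> y \<in> Rm}" using form(7) by simp
  then show ?thesis using that by blast
qed

lemma inter: "x \<in> Rp \<Longrightarrow> x \<in> Rm \<Longrightarrow> x = 0"
  using form(8) by blast

text \<open>A vector of \<open>Rp\<close> is orthogonal to \<open>Rp\<close> by isotropy;
  orthogonality to \<open>Rm\<close> then makes it orthogonal to the whole space.\<close>

lemma separated:
  assumes "x \<in> Rp" "\<And>w. w \<in> Rm \<Longrightarrow> F x w = 0"
  shows "x = 0"
proof (rule F_nondeg)
  fix y
  obtain p m where "p \<in> Rp" "m \<in> Rm" "y = p + m" by (rule decompose)
  then show "F x y = 0" using assms by (simp add: F_lin isotropic)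
qed

abbreviation ev :: "'r \<Rightarrow> 'r \<Rightarrow> 'k" where "ev w \<equiv> (\<lambda>x. F x w)"

lemma separated_ev:
  assumes "x \<in> Rp" "\<And>g. g \<in> ev ` Rm \<Longrightarrow> g x = 0"
  shows "x = 0"
  using assms(1)
proof (rule separated)
  show "F x w = 0" if "w \<in> Rm" for w using assms(2)[of "ev w"] that by blast
qed

abbreviation ev2 :: "'r \<Rightarrow> 'r \<Rightarrow> ('k, 'r) tensor2 \<Rightarrow> 'k" where "ev2 v w \<equiv> (\<lambda>t. t (ev v) (ev w))"

lemma separated2:
  assumes "t \<in> T2 Rp" "\<And>v w. v \<in> Rm \<Longrightarrow> w \<in> Rm \<Longrightarrow> t (ev v) (ev w) = 0"
  shows "t = 0"
  by (rule tensor_prod_separated[where ?G1.0 = "ev ` Rm" and ?G2.0 = "ev ` Rm",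
        OF vector_space_axioms vector_space_axioms subspaces(1) subspaces(1) _ _ _ _ assms(1)])
    (use assms(2) lin_F in \<open>auto intro: separated_ev\<close>)

text \<open>The first factor is itself a tensor square of \<open>Rp\<close>, and by
  \<open>separated2\<close> the evaluations \<open>ev2 v w\<close> separate it.\<close>

lemma separated3:
  assumes "T \<in> T3 Rp" "\<And>u v w. u \<in> Rm \<Longrightarrow> v \<in> Rm \<Longrightarrow> w \<in> Rm \<Longrightarrow> T (ev2 u v) (ev w) = 0"
  shows "T = 0"
proof (rule tensor_prod_separated[where ?G1.0 = "(\<lambda>(v, w). ev2 v w) ` (Rm \<times> Rm)" and ?G2.0 = "ev ` Rm",
        OF vector_space_tscale vector_space_axioms subspace_T2[OF subspaces(1)] subspaces(1) _ _ _ _ assms(1)])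
  fix x :: "('k, 'r) tensor2"
  assume x: "x \<in> T2 Rp" and z: "\<And>g. g \<in> (\<lambda>(v, w). ev2 v w) ` (Rm \<times> Rm) \<Longrightarrow> g x = 0"
  show "x = 0"
  proof (rule separated2[OF x])
    fix v w assume "v \<in> Rm" "w \<in> Rm"
    then have "ev2 v w \<in> (\<lambda>(v, w). ev2 v w) ` (Rm \<times> Rm)" by (intro image_eqI[of _ _ "(v, w)"]) auto
    from z[OF this] show "x (ev v) (ev w) = 0" .
  qed
qed (use assms(2) lin_F lin_eval in \<open>auto intro: separated_ev\<close>)

section \<open>Evaluation of tensors at vectors of the ambient space\<close>

lemma eval_sum: "(\<Sum>i<(n::nat). tens scale scale (a i) (b i)) (ev v) (ev w) = (\<Sum>i<n. F (a i) v * F (b i) w)"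
  by (simp add: sum_fun_apply2 tens_apply lin_F)

lemma eval_lin:
  assumes "t \<in> T2 UNIV"
  shows "t (ev (x + y)) (ev z) = t (ev x) (ev z) + t (ev y) (ev z)"
    "t (ev z) (ev (x + y)) = t (ev z) (ev x) + t (ev z) (ev y)"
proof -
  obtain n a b where t: "t = (\<Sum>i<(n::nat). tens scale scale (a i) (b i))"
    using assms by (blast elim: tensor_prodE)
  show "t (ev (x + y)) (ev z) = t (ev x) (ev z) + t (ev y) (ev z)"
    "t (ev z) (ev (x + y)) = t (ev z) (ev x) + t (ev z) (ev y)"
    unfolding t eval_sum by (simp_all add: F_lin algebra_simps sum.distrib)
qed

lemma eval_Rp:
  assumes "t \<in> T2 Rp" "x \<in> Rp"
  shows "t (ev x) (ev z) = 0" "t (ev z) (ev x) = 0"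
proof -
  obtain n a b where ab: "\<And>i. i < (n::nat) \<Longrightarrow> a i \<in> Rp \<and> b i \<in> Rp"
    and t: "t = (\<Sum>i<n. tens scale scale (a i) (b i))"
    using assms(1) by (blast elim: tensor_prodE)
  show "t (ev x) (ev z) = 0" "t (ev z) (ev x) = 0"
    unfolding t eval_sum using ab assms(2) by (simp_all add: isotropic)
qed

text \<open>The component of an argument in the isotropic \<open>Rp\<close> is invisible to tensors
  over \<open>Rp\<close>. Mixed brackets may thus be replaced by their part in \<open>Rm\<close>,
  and points of a graph over \<open>Rm\<close> by their base points.\<close>

lemma eval_add_Rp:
  assumes "t \<in> T2 Rp" "x \<in> Rp"
  shows "t (ev (y + x)) (ev z) = t (ev y) (ev z)" "t (ev z) (ev (y + x)) = t (ev z) (ev y)"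
    "t (ev (x + y)) (ev z) = t (ev y) (ev z)" "t (ev z) (ev (x + y)) = t (ev z) (ev y)"
  using T2_UNIV[OF assms(1)] eval_Rp[OF assms] by (simp_all add: eval_lin)

text \<open>Turns the pairing condition of \<open>determines_cobracket\<close> into a condition on
  the values of tensors.\<close>

lemma form2_eq:
  assumes "t \<in> T2 UNIV"
  shows "form2 scale F t (tens2 scale v w) = t (ev v) (ev w)"
proof -
  obtain n a b where t: "t = (\<Sum>i<(n::nat). tens scale scale (a i) (b i))"
    using assms by (blast elim: tensor_prodE)
  have inner: "lift2 scale (\<lambda>b1 b2. F a1 b1 * F a2 b2) (tens2 scale v w) = F a1 v * F a2 w" for a1 a2
  proof -
    have "bilinear_on scale UNIV scale UNIV (*) (\<lambda>b1 b2. F a1 b1 * F a2 b2)"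
      unfolding bilinear_on_def by (auto simp: F_lin algebra_simps)
    from lift2_eq[OF vector_space_mult this, where n = 1 and a = "\<lambda>_. v" and b = "\<lambda>_. w"] show ?thesis by (simp add: tens2_def)
  qed
  have "bilinear_on scale UNIV scale UNIV (*) (\<lambda>a1 a2. F a1 v * F a2 w)"
    unfolding bilinear_on_def by (auto simp: F_lin algebra_simps)
  then show ?thesis unfolding form2_def inner t eval_sum by (rule lift2_eq[OF vector_space_mult])
qed

lemma wedge2_eval:
  assumes "t \<in> wedge2 scale S" "lin scale \<phi>" "lin scale \<psi>"
  shows "t \<psi> \<phi> = - t \<phi> \<psi>"
  using swap_apply[OF T2_UNIV[of t S], of \<phi> \<psi>] assms unfolding wedge2_def by simp

lemma wedge2_T2: "t \<in> wedge2 scale S \<Longrightarrow> t \<in> T2 S"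
  unfolding wedge2_def by simp

lemma wedge2I:
  assumes "t \<in> T2 Rp" "\<And>v w. v \<in> Rm \<Longrightarrow> w \<in> Rm \<Longrightarrow> t (ev v) (ev w) = - t (ev w) (ev v)"
  shows "t \<in> wedge2 scale Rp"
proof -
  interpret t: vector_space "tscale :: 'k \<Rightarrow> ('k, 'r) tensor2 \<Rightarrow> _" by (rule vector_space_tscale)
  let ?s = "lift2 scale (\<lambda>a b. tens2 scale b a) t"
  have "?s + t = 0"
  proof (rule separated2)
    show "?s + t \<in> T2 Rp"
      by (intro t.subspace_add[OF subspace_T2] swap_in_T2 subspaces assms(1))
    show "(?s + t) (ev v) (ev w) = 0" if "v \<in> Rm" "w \<in> Rm" for v w
      using swap_apply[OF T2_UNIV[OF assms(1)] lin_F(1) lin_F(1), of v w] assms(2)[OF that] by simp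
  qed
  then have "?s = - t" by (simp add: eq_neg_iff_add_eq_0)
  then show ?thesis using assms(1) unfolding wedge2_def by simp
qed

lemma diag_action_sum:
  "diag_action scale br x (\<Sum>i<(n::nat). tens scale scale (a i) (b i)) =
    (\<Sum>i<n. tens2 scale (br x (a i)) (b i) + tens2 scale (a i) (br x (b i)))"
  unfolding diag_action_def
  by (rule lift2_eq[OF vector_space_tscale])
    (auto simp: bilinear_on_def tens2_lin br_lin tscale_add ac_simps)

lemma diag_action_in_T2:
  assumes "t \<in> T2 Rp" "x \<in> Rp"
  shows "diag_action scale br x t \<in> T2 Rp"
proof -
  interpret t: vector_space "tscale :: 'k \<Rightarrow> ('k, 'r) tensor2 \<Rightarrow> _" by (rule vector_space_tscale)
  obtain n a b where ab: "\<And>i. i < (n::nat) \<Longrightarrow> a i \<in> Rp \<and> b i \<in> Rp"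
    and t: "t = (\<Sum>i<n. tens scale scale (a i) (b i))"
    using assms(1) by (blast elim: tensor_prodE)
  note s = subspace_T2[OF subspaces(1)]
  show ?thesis unfolding t diag_action_sum
    using ab assms(2) by (intro t.subspace_sum[OF s] t.subspace_add[OF s] tens2_in_T2) (auto intro: br_closed)
qed

text \<open>Cyclic symmetry of the form moves the bracket with \<open>x\<close> from the factors of
  \<open>t\<close> to the arguments.\<close>

lemma diag_action_eval:
  assumes "t \<in> T2 UNIV"
  shows "diag_action scale br x t (ev v) (ev w) = t (ev (br v x)) (ev w) + t (ev v) (ev (br w x))"
proof -
  obtain n a b where t: "t = (\<Sum>i<(n::nat). tens scale scale (a i) (b i))"
    using assms by (blast elim: tensor_prodE)
  show ?thesis unfolding t diag_action_sum eval_sum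
    by (simp add: sum_fun_apply2 tens2_apply lin_F sum.distrib F_rot)
qed

section \<open>Cobrackets dual to the bracket\<close>

text \<open>Every Lie bialgebra axiom is an identity of tensors over \<open>Rp\<close>, so it may be tested against \<open>Rm\<close>, where
  it becomes a consequence of invariance or of the Jacobi identity.\<close>

context
  fixes \<delta> :: "'r \<Rightarrow> ('k, 'r) tensor2"
  assumes \<delta>_T2: "a \<in> Rp \<Longrightarrow> \<delta> a \<in> T2 Rp"
    and \<delta>_eval: "a \<in> Rp \<Longrightarrow> v \<in> Rm \<Longrightarrow> w \<in> Rm \<Longrightarrow> \<delta> a (ev v) (ev w) = F a (br v w)"
begin

lemma dual_add:
  assumes "a \<in> Rp" "b \<in> Rp"
  shows "\<delta> (a + b) = \<delta> a + \<delta> b"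
proof -
  interpret t: vector_space "tscale :: 'k \<Rightarrow> ('k, 'r) tensor2 \<Rightarrow> _" by (rule vector_space_tscale)
  have ab: "a + b \<in> Rp" using assms subspaces subspace_add by blast
  have "\<delta> (a + b) - (\<delta> a + \<delta> b) = 0"
    by (rule separated2)
      (auto intro!: t.subspace_add[OF subspace_T2] t.subspace_diff[OF subspace_T2]
        simp: \<delta>_T2 \<delta>_eval ab assms subspaces F_lin)
  then show ?thesis by simp
qed

lemma dual_scale:
  assumes "a \<in> Rp"
  shows "\<delta> (scale c a) = tscale c (\<delta> a)"
proof -
  interpret t: vector_space "tscale :: 'k \<Rightarrow> ('k, 'r) tensor2 \<Rightarrow> _" by (rule vector_space_tscale)
  have ca: "scale c a \<in> Rp" using assms subspaces subspace_scale by blast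
  have "tscale c (\<delta> a) (ev v) (ev w) = c * \<delta> a (ev v) (ev w)" for v w
    by (simp add: tscale_def)
  then have "\<delta> (scale c a) - tscale c (\<delta> a) = 0"
    by (intro separated2)
      (auto intro!: t.subspace_scale[OF subspace_T2] t.subspace_diff[OF subspace_T2]
        simp: \<delta>_T2 \<delta>_eval ca assms subspaces F_lin)
  then show ?thesis by simp
qed

text \<open>By duality, applying \<open>\<delta>\<close> to the first factor amounts to feeding a
  bracket into the first slot.\<close>

lemma dual_cobracket_id:
  assumes "t \<in> T2 Rp"
  shows "cobracket_id scale Rp \<delta> t \<in> T3 Rp"
    and "u \<in> Rm \<Longrightarrow> v \<in> Rm \<Longrightarrow> w \<in> Rm \<Longrightarrow>
      cobracket_id scale Rp \<delta> t (ev2 u v) (ev w) = t (ev (br u v)) (ev w)"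
proof -
  obtain n a b where ab: "\<And>i. i < (n::nat) \<Longrightarrow> a i \<in> Rp \<and> b i \<in> Rp"
    and t: "t = (\<Sum>i<n. tens scale scale (a i) (b i))"
    using assms by (blast elim: tensor_prodE)
  have eq: "cobracket_id scale Rp \<delta> t = (\<Sum>i<n. tens tscale scale (\<delta> (a i)) (b i))"
    unfolding t by (rule cobracket_id_eq[OF subspaces(1) dual_add dual_scale ab])
  show "cobracket_id scale Rp \<delta> t \<in> T3 Rp"
    unfolding eq using ab \<delta>_T2 by (intro tensor_prodI) auto
  show "cobracket_id scale Rp \<delta> t (ev2 u v) (ev w) = t (ev (br u v)) (ev w)"
    if "u \<in> Rm" "v \<in> Rm" "w \<in> Rm"
    unfolding eq unfolding t eval_sum using ab that
    by (auto simp: sum_fun_apply2 tens_apply lin_eval lin_F \<delta>_eval intro!: sum.cong)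
qed

text \<open>Tested on \<open>v\<close> and \<open>w\<close>, the diagonal actions combine to
  \<open>F (br v a) (br w b) - F (br w a) (br v b)\<close>, which invariance and the Jacobi identity
  turn into \<open>F a (br b (br v w))\<close>.\<close>

lemma dual_cocycle:
  assumes a: "a \<in> Rp" and b: "b \<in> Rp"
  shows "\<delta> (br a b) = diag_action scale br a (\<delta> b) - diag_action scale br b (\<delta> a)"
proof -
  interpret t: vector_space "tscale :: 'k \<Rightarrow> ('k, 'r) tensor2 \<Rightarrow> _" by (rule vector_space_tscale)
  let ?R = "diag_action scale br a (\<delta> b) - diag_action scale br b (\<delta> a)"
  have "\<delta> (br a b) - ?R = 0"
  proof (rule separated2)
    show "\<delta> (br a b) - ?R \<in> T2 Rp"
      by (intro t.subspace_diff[OF subspace_T2] subspaces diag_action_in_T2 \<delta>_T2 br_closed a b)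
    fix v w assume v: "v \<in> Rm" and w: "w \<in> Rm"
    \<comment> \<open>Mixed brackets lie in neither summand, while the duality of
      \<open>\<delta>\<close> is available on \<open>Rm\<close> only; hence the components.\<close>
    obtain p1 m1 where 1: "p1 \<in> Rp" "m1 \<in> Rm" "br v a = p1 + m1" by (rule decompose)
    obtain p2 m2 where 2: "p2 \<in> Rp" "m2 \<in> Rm" "br w a = p2 + m2" by (rule decompose)
    obtain q1 n1 where 3: "q1 \<in> Rp" "n1 \<in> Rm" "br v b = q1 + n1" by (rule decompose)
    obtain q2 n2 where 4: "q2 \<in> Rp" "n2 \<in> Rm" "br w b = q2 + n2" by (rule decompose)
    have left: "F x (br m w') = F (br w' x) m" and right: "F x (br v' m) = - F (br v' x) m" for x m v' w'
      using F_rot[of w' x m] F_inv[of x v' m] br_antisym[of x v'] by (simp_all add: F_minus)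
    have "?R (ev v) (ev w) = F b (br m1 w) + F b (br v m2) - (F a (br n1 w) + F a (br v n2))"
      by (simp add: diag_action_eval[OF T2_UNIV[OF \<delta>_T2]] \<delta>_T2 a b 1 2 3 4 eval_add_Rp \<delta>_eval v w)
    also have "\<dots> = F q2 m1 - F q1 m2 - F p2 n1 + F p1 n2"
      unfolding left[of b m1 w] left[of a n1 w] right[of b v m2] right[of a v n2]
      by (simp add: 1 2 3 4 F_lin isotropic)
    \<comment> \<open>Isotropy of both summands kills the products of like components, so the four
      terms reassemble into two pairings of full brackets.\<close>
    also have "\<dots> = F (br w a) (br v b) * (-1) + F (br v a) (br w b)"
      by (simp add: 1 2 3 4 F_lin isotropic F_sym[of m1 q2] F_sym[of m2 q1])
    also have "\<dots> = F a (br b (br v w))"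
    proof -
      have "br b (br v w) = - (br v (br w b) + br w (br b v))"
        using jacobi[of b v w] by (simp only: eq_neg_iff_add_eq_0 add.assoc)
      then have "F a (br b (br v w)) = - F a (br v (br w b)) - F a (br w (br b v))"
        by (simp add: F_minus F_lin F_diff)
      then show ?thesis
        using right[of a v "br w b"] right[of a w "br b v"] br_antisym[of b v] by (simp add: F_minus)
    qed
    also have "\<dots> = \<delta> (br a b) (ev v) (ev w)"
      by (simp add: \<delta>_eval a b v w br_closed F_inv)
    finally show "(\<delta> (br a b) - ?R) (ev v) (ev w) = 0" by simp
  qed
  then show ?thesis by simp
qed

text \<open>On arguments from \<open>Rm\<close> the alternation is the pairing of \<open>a\<close>
  with the cyclic sum of double brackets, which vanishes by the Jacobi identity.\<close>

lemma dual_co_jacobi: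
  assumes "a \<in> Rp"
  shows "alt scale (cobracket_id scale Rp \<delta> (\<delta> a)) = 0"
proof (rule separated3)
  note T = dual_cobracket_id[OF \<delta>_T2[OF assms]]
  show "alt scale (cobracket_id scale Rp \<delta> (\<delta> a)) \<in> T3 Rp"
    by (intro alt_in_T3 subspaces T)
  fix u v w assume "u \<in> Rm" "v \<in> Rm" "w \<in> Rm"
  moreover have "F a (br (br u v) w) + F a (br (br v w) u) + F a (br (br w u) v) = 0"
  proof -
    have "br (br u v) w + br (br v w) u + br (br w u) v = 0"
      using arg_cong[OF jacobi[of u v w], of uminus]
        br_antisym[of w "br u v"] br_antisym[of u "br v w"] br_antisym[of v "br w u"]
      by (simp add: ac_simps)
    then show ?thesis by (metis F_lin(2) F_zero(2))
  qed
  ultimately show "alt scale (cobracket_id scale Rp \<delta> (\<delta> a)) (ev2 u v) (ev w) = 0"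
    by (simp add: alt_apply[OF T3_UNIV[OF T(1)]] lin_F T(2) \<delta>_eval assms br_closed)
qed

lemma dual_determines: "determines_cobracket scale br F Rp Rm \<delta>"
proof -
  have "\<delta> a \<in> wedge2 scale Rp" if "a \<in> Rp" for a
  proof (rule wedge2I[OF \<delta>_T2[OF that]])
    fix v w assume "v \<in> Rm" "w \<in> Rm"
    then show "\<delta> a (ev v) (ev w) = - \<delta> a (ev w) (ev v)"
      using br_antisym[of v w] that by (simp add: \<delta>_eval F_minus)
  qed
  then have "lie_bialgebra scale br Rp \<delta>"
    unfolding lie_bialgebra_def
    using lie form(5) dual_add dual_scale dual_cocycle dual_co_jacobi by blast
  then show ?thesis
    unfolding determines_cobracket_def
    using manin_triple form2_eq[OF T2_UNIV[OF \<delta>_T2]] \<delta>_eval by simp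
qed

end

section \<open>The twist equation\<close>

lemma twist_map_sum:
  "twist_map scale F (\<Sum>i<(n::nat). tens scale scale (a i) (b i)) w = (\<Sum>i<n. scale (F w (a i)) (b i))"
  unfolding twist_map_def
  by (rule lift2_eq[OF vector_space_axioms])
    (auto simp: bilinear_on_def F_lin scale_left_distrib scale_right_distrib mult.commute)

lemma twist_map_in:
  assumes "t \<in> T2 Rp"
  shows "twist_map scale F t w \<in> Rp"
proof -
  obtain n a b where ab: "\<And>i. i < (n::nat) \<Longrightarrow> a i \<in> Rp \<and> b i \<in> Rp"
    and t: "t = (\<Sum>i<n. tens scale scale (a i) (b i))"
    using assms by (blast elim: tensor_prodE)
  show ?thesis unfolding t twist_map_sum using ab
    by (intro subspace_sum subspace_scale subspaces) auto
qed

text \<open>Relates the two readings of \<open>t\<close>, as a map into \<open>Rp\<close> and as a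
  bilinear form on arguments, so that skewness passes from one to the other.\<close>

lemma twist_map_F:
  assumes "t \<in> T2 UNIV"
  shows "F (twist_map scale F t v) w = t (ev v) (ev w)"
proof -
  obtain n a b where t: "t = (\<Sum>i<(n::nat). tens scale scale (a i) (b i))"
    using assms by (blast elim: tensor_prodE)
  show ?thesis unfolding t twist_map_sum eval_sum by (simp add: F_sum F_lin F_sym)
qed

lemma twist_map_lin:
  assumes "t \<in> T2 UNIV"
  shows "twist_map scale F t (v + w) = twist_map scale F t v + twist_map scale F t w"
    "twist_map scale F t (scale c v) = scale c (twist_map scale F t v)"
proof -
  obtain n a b where t: "t = (\<Sum>i<(n::nat). tens scale scale (a i) (b i))"
    using assms by (blast elim: tensor_prodE)
  show "twist_map scale F t (v + w) = twist_map scale F t v + twist_map scale F t w"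
    "twist_map scale F t (scale c v) = scale c (twist_map scale F t v)"
    unfolding t twist_map_sum
    by (simp_all add: F_lin scale_left_distrib sum.distrib scale_sum_right)
qed

lemma twist_map_skew:
  assumes "t \<in> wedge2 scale Rp"
  shows "F (twist_map scale F t v) w = - F (twist_map scale F t w) v"
  unfolding twist_map_F[OF T2_UNIV[OF wedge2_T2[OF assms]]] by (rule wedge2_eval[OF assms lin_F(1) lin_F(1)])

section \<open>Values of \<open>cyb\<close> on skew tensors and the form on the graph\<close>

definition cyb_term :: "'r \<Rightarrow> 'r \<Rightarrow> 'r \<Rightarrow> 'r \<Rightarrow> ('k, 'r) tensor3" where
  "cyb_term a b c d = tens3 scale (tens2 scale (br a c) b) d + tens3 scale (tens2 scale a (br b c)) d
     + tens3 scale (tens2 scale a c) (br b d)"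

lemma cyb_sum:
  "cyb scale br (\<Sum>i<(n::nat). tens scale scale (a i) (b i)) =
    (\<Sum>i<n. \<Sum>j<n. cyb_term (a i) (b i) (a j) (b j))"
proof -
  interpret t: vector_space "tscale :: 'k \<Rightarrow> ('k, 'r) tensor3 \<Rightarrow> _" by (rule vector_space_tscale)
  have inner: "bilinear_on scale UNIV scale UNIV tscale (\<lambda>c d. cyb_term x y c d)" for x y
    unfolding bilinear_on_def cyb_term_def
    by (auto simp: tens2_lin tens3_lin br_lin tscale_add ac_simps)
  have "bilinear_on scale UNIV scale UNIV tscale (\<lambda>x y. cyb_term x y c d)" for c d
    unfolding bilinear_on_def cyb_term_def
    by (auto simp: tens2_lin tens3_lin br_lin tscale_add ac_simps)
  then have outer: "bilinear_on scale UNIV scale UNIV tscale (\<lambda>x y. \<Sum>j<n. cyb_term x y (a j) (b j))"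
    unfolding bilinear_on_def by (simp add: sum.distrib t.scale_sum_right)
  show ?thesis
    unfolding cyb_def cyb_term_def[symmetric] lift2_eq[OF vector_space_tscale inner]
    by (rule lift2_eq[OF vector_space_tscale outer])
qed

lemma cyb_in_T3:
  assumes "t \<in> T2 Rp"
  shows "cyb scale br t \<in> T3 Rp"
proof -
  interpret t: vector_space "tscale :: 'k \<Rightarrow> ('k, 'r) tensor3 \<Rightarrow> _" by (rule vector_space_tscale)
  obtain n a b where ab: "\<And>i. i < (n::nat) \<Longrightarrow> a i \<in> Rp \<and> b i \<in> Rp"
    and t: "t = (\<Sum>i<n. tens scale scale (a i) (b i))"
    using assms by (blast elim: tensor_prodE)
  note s = subspace_T3[OF subspaces(1)]
  show ?thesis unfolding t cyb_sum cyb_term_def using ab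
    by (intro t.subspace_sum[OF s] t.subspace_add[OF s] tens3_in_T3 tens2_in_T2 br_closed) auto
qed

text \<open>Contracting the first factors of a skew \<open>t\<close> with \<open>x\<close> gives
  \<open>f x\<close>, contracting the second factors gives \<open>- f x\<close>. Each summand of
  \<open>cyb\<close> contracts the two factors outside its bracket and so leaves a bracket of two
  such vectors.\<close>

lemma cyb_eval:
  assumes "t \<in> wedge2 scale Rp"
  defines "f \<equiv> twist_map scale F t"
  shows "cyb scale br t (ev2 u v) (ev w) =
    F w (br (f u) (f v)) + F u (br (f v) (f w)) + F v (br (f w) (f u))"
proof -
  note t_UNIV = T2_UNIV[OF wedge2_T2[OF assms(1)]]
  obtain n a b where t: "t = (\<Sum>i<(n::nat). tens scale scale (a i) (b i))"
    using t_UNIV by (blast elim: tensor_prodE)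
  have f: "f x = (\<Sum>i<n. scale (F (a i) x) (b i))" for x
    unfolding f_def t twist_map_sum by (simp add: F_sym)
  have g: "(\<Sum>i<n. scale (F (b i) x) (a i)) = - f x" for x
  proof -
    have "(\<Sum>i<n. scale (F (b i) x) (a i)) + f x = 0"
    proof (rule F_nondeg)
      fix y
      have "F (\<Sum>i<n. scale (F (b i) x) (a i)) y = t (ev y) (ev x)"
        unfolding t eval_sum by (simp add: F_sum F_lin mult.commute)
      also have "\<dots> = F (f y) x" unfolding f_def by (rule twist_map_F[OF t_UNIV, symmetric])
      also have "\<dots> = - F (f x) y" unfolding f_def by (rule twist_map_skew[OF assms(1)])
      finally show "F ((\<Sum>i<n. scale (F (b i) x) (a i)) + f x) y = 0" by (simp add: F_lin)
    qed
    then show ?thesis by (simp only: eq_neg_iff_add_eq_0)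
  qed
  have 1: "(\<Sum>i<n. \<Sum>j<n. F (br (a i) (a j)) u * F (b i) v * F (b j) w) = F (br (- f v) (- f w)) u"
    unfolding g[symmetric] F_br_sum by (simp add: mult_ac)
  have 2: "(\<Sum>i<n. \<Sum>j<n. F (a i) u * F (br (b i) (a j)) v * F (b j) w) = F (br (f u) (- f w)) v"
    unfolding g[symmetric] unfolding f F_br_sum by (simp add: mult_ac)
  have 3: "(\<Sum>i<n. \<Sum>j<n. F (a i) u * F (a j) v * F (br (b i) (b j)) w) = F (br (f u) (f v)) w"
    unfolding f F_br_sum by (simp add: mult_ac)
  have neg: "br (- x) y = - br x y" "br x (- y) = - br x y" for x y
    using br_lin(3)[of "-1" x y] br_lin(4)[of x "-1" y] by simp_all
  have "cyb scale br t (ev2 u v) (ev w) =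
      F (br (- f v) (- f w)) u + F (br (f u) (- f w)) v + F (br (f u) (f v)) w"
    unfolding 1[symmetric] 2[symmetric] 3[symmetric]
    unfolding t cyb_sum
    by (simp add: sum_fun_apply2 cyb_term_def tens3_apply tens2_apply lin_F sum.distrib mult_ac)
  \<comment> \<open>The first bracket carries two minus signs, which cancel; the second carries one,
    which reverses the bracket.\<close>
  also have "\<dots> = F w (br (f u) (f v)) + F u (br (f v) (f w)) + F v (br (f w) (f u))"
    using br_antisym[of "f u" "f w"] by (simp add: neg F_minus F_sym)
  finally show ?thesis .
qed

text \<open>Of the eight terms of the expansion, the one without \<open>f\<close> and the one with
  three occurrences of \<open>f\<close> vanish by isotropy. Those with two occurrences make up
  \<open>cyb\<close>; those with one remain for comparison with the cobracket.\<close>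

lemma graph_form:
  assumes "t \<in> wedge2 scale Rp" "u \<in> Rm" "v \<in> Rm" "w \<in> Rm"
  defines "f \<equiv> twist_map scale F t"
  shows "F (br (u + f u) (v + f v)) (w + f w) = cyb scale br t (ev2 u v) (ev w)
    + F (f w) (br u v) + F (f u) (br v w) + F (f v) (br w u)"
proof -
  have f: "f x \<in> Rp" for x unfolding f_def by (rule twist_map_in[OF wedge2_T2[OF assms(1)]])
  have "F (br (u + f u) (v + f v)) (w + f w) =
      F (br u v) (f w) + F (br u (f v)) w + F (br u (f v)) (f w) + F (br (f u) v) w + F (br (f u) v) (f w)
      + F (br (f u) (f v)) w"
    by (simp add: br_lin F_lin isotropic br_closed f assms(2-4))
  also have "\<dots> = F (f w) (br u v) + F (f v) (br w u) + F u (br (f v) (f w)) + F (f u) (br v w)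
      + F v (br (f w) (f u)) + F w (br (f u) (f v))"
    using F_rot[of u "f v" w] F_inv[of u "f v" "f w"] F_inv[of "f u" v w] F_rot[of "f u" v "f w"]
      F_sym[of "br u v" "f w"] F_sym[of "br (f u) (f v)" w] by simp
  finally show ?thesis unfolding cyb_eval[OF assms(1), folded f_def] by (simp add: ac_simps)
qed

section \<open>The graph as a Lagrangian complement\<close>

lemma twisted_subspace:
  assumes "t \<in> T2 UNIV"
  shows "subspace (twisted scale F Rm t)"
proof (rule subspaceI)
  let ?f = "twist_map scale F t"
  have "?f 0 = 0" using twist_map_lin(2)[OF assms, of 0 0] by simp
  then show "0 \<in> twisted scale F Rm t"
    unfolding twisted_def using subspace_0[OF subspaces(2)] by force
  fix x y assume "x \<in> twisted scale F Rm t" "y \<in> twisted scale F Rm t"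
  then obtain v w where "v \<in> Rm" "x = v + ?f v" "w \<in> Rm" "y = w + ?f w"
    unfolding twisted_def by blast
  moreover from this have "x + y = (v + w) + ?f (v + w)"
    by (simp add: twist_map_lin[OF assms] ac_simps)
  ultimately show "x + y \<in> twisted scale F Rm t"
    unfolding twisted_def using subspace_add[OF subspaces(2)] by blast
next
  let ?f = "twist_map scale F t"
  fix c x assume "x \<in> twisted scale F Rm t"
  then obtain v where "v \<in> Rm" "x = v + ?f v" unfolding twisted_def by blast
  moreover from this have "scale c x = scale c v + ?f (scale c v)"
    by (simp add: twist_map_lin[OF assms] scale_right_distrib)
  ultimately show "scale c x \<in> twisted scale F Rm t"
    unfolding twisted_def using subspace_scale[OF subspaces(2)] by blast
qed

lemma twisted_decompose:
  assumes "t \<in> T2 Rp"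
  obtains p m where "p \<in> Rp" "m \<in> twisted scale F Rm t" "x = p + m"
proof -
  let ?f = "twist_map scale F t"
  obtain p w where "p \<in> Rp" "w \<in> Rm" "x = p + w" by (rule decompose)
  moreover have "p - ?f w \<in> Rp" using \<open>p \<in> Rp\<close> twist_map_in[OF assms] subspace_diff[OF subspaces(1)] by blast
  moreover have "w + ?f w \<in> twisted scale F Rm t" unfolding twisted_def using \<open>w \<in> Rm\<close> by blast
  ultimately show ?thesis by (intro that[of "p - ?f w" "w + ?f w"]) simp_all
qed

lemma twisted_isotropic:
  assumes "t \<in> wedge2 scale Rp" "x \<in> twisted scale F Rm t" "y \<in> twisted scale F Rm t"
  shows "F x y = 0"
proof -
  let ?f = "twist_map scale F t"
  obtain v w where vw: "v \<in> Rm" "x = v + ?f v" "w \<in> Rm" "y = w + ?f w"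
    using assms(2,3) unfolding twisted_def by blast
  show ?thesis
    using twist_map_skew[OF assms(1), of v w] F_sym[of v "?f w"] twist_map_in[OF wedge2_T2[OF assms(1)]]
    by (simp add: vw F_lin isotropic)
qed

text \<open>The twisted subspace is Lagrangian, so it is closed under the bracket as soon as
  \<open>F (br x y) z\<close> vanishes on it.\<close>

lemma twisted_lagrangian:
  assumes "t \<in> wedge2 scale Rp" "\<And>y. y \<in> twisted scale F Rm t \<Longrightarrow> F x y = 0"
  shows "x \<in> twisted scale F Rm t"
proof -
  obtain p m where x: "p \<in> Rp" "m \<in> twisted scale F Rm t" "x = p + m"
    by (rule twisted_decompose[OF wedge2_T2[OF assms(1)]])
  \<comment> \<open>\<open>p\<close> is orthogonal to \<open>Rp\<close> by isotropy and to the graph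
    because \<open>x\<close> and \<open>m\<close> are; together these span the space.\<close>
  have "p = 0"
  proof (rule F_nondeg)
    fix y
    obtain p' m' where y: "p' \<in> Rp" "m' \<in> twisted scale F Rm t" "y = p' + m'"
      by (rule twisted_decompose[OF wedge2_T2[OF assms(1)]])
    have "F p m' = 0" using assms(2)[OF y(2)] twisted_isotropic[OF assms(1) x(2) y(2)] by (simp add: x F_lin)
    then show "F p y = 0" by (simp add: y F_lin isotropic x)
  qed
  then show ?thesis using x by simp
qed

lemma twisted_manin:
  assumes t: "t \<in> wedge2 scale Rp" and sub: "lie_subalgebra scale br (twisted scale F Rm t)"
  shows "manin_triple scale br F Rp (twisted scale F Rm t)"
proof -
  let ?W = "twisted scale F Rm t"
  have "x \<in> {x + y | x y. x \<in> Rp \<and> y \<in> ?W}" for x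
    using twisted_decompose[OF wedge2_T2[OF t], of x] by blast
  then have sum: "{x + y | x y. x \<in> Rp \<and> y \<in> ?W} = UNIV" by blast
  \<comment> \<open>A common vector of two isotropic subspaces is orthogonal to both, hence to their
    sum.\<close>
  have "x = 0" if x: "x \<in> Rp" "x \<in> ?W" for x
  proof (rule F_nondeg)
    fix y
    obtain p m where "p \<in> Rp" "m \<in> ?W" "y = p + m" by (rule twisted_decompose[OF wedge2_T2[OF t]])
    then show "F x y = 0" using x by (simp add: F_lin isotropic twisted_isotropic[OF t])
  qed
  moreover have "0 \<in> Rp" "0 \<in> ?W"
    using sub subspace_0 subspaces(1) unfolding lie_subalgebra_def by blast+
  ultimately have int: "Rp \<inter> ?W = {0}" by blast
  have "?W \<subseteq> perp F ?W" unfolding perp_def using twisted_isotropic[OF t] by blast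
  then show ?thesis
    unfolding manin_triple_def using lie form(1-5,9) sub sum int by (intro conjI)
qed

text \<open>\<open>Rp\<close> meets \<open>Rm\<close> in 0, so the component in \<open>Rm\<close> of
  a point of the graph is its base point; the subspace therefore remembers the map.\<close>

lemma twist_map_unique:
  assumes "t \<in> T2 Rp" "w \<in> Rm" "p \<in> Rp" "w + p \<in> twisted scale F Rm t"
  shows "twist_map scale F t w = p"
proof -
  let ?f = "twist_map scale F t"
  obtain v where v: "v \<in> Rm" "w + p = v + ?f v" using assms(4) unfolding twisted_def by blast
  then have eq: "w - v = ?f v - p" by (simp add: algebra_simps)
  have "w - v \<in> Rm" using v assms subspace_diff subspaces(2) by blast
  moreover have "w - v \<in> Rp"
    unfolding eq using assms(3) twist_map_in[OF assms(1)] subspace_diff[OF subspaces(1)] by blast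
  ultimately have "w - v = 0" using inter by blast
  then show ?thesis using eq by simp
qed

text \<open>The graph gives back the map on \<open>Rm\<close>, and pairing its values with
  \<open>Rm\<close> gives the values of the tensor that determine it.\<close>

lemma twisted_inj:
  assumes t: "t \<in> T2 Rp" and u: "u \<in> T2 Rp" and eq: "twisted scale F Rm t = twisted scale F Rm u"
  shows "t = u"
proof -
  interpret t: vector_space "tscale :: 'k \<Rightarrow> ('k, 'r) tensor2 \<Rightarrow> _" by (rule vector_space_tscale)
  have "t - u = 0"
  proof (rule separated2)
    show "t - u \<in> T2 Rp" by (intro t.subspace_diff[OF subspace_T2] subspaces t u)
    fix v w assume "v \<in> Rm" "w \<in> Rm"
    have "v + twist_map scale F u v \<in> twisted scale F Rm t"
      unfolding eq unfolding twisted_def using \<open>v \<in> Rm\<close> by blast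
    from twist_map_unique[OF t \<open>v \<in> Rm\<close> twist_map_in[OF u] this]
    show "(t - u) (ev v) (ev w) = 0"
      using twist_map_F[OF T2_UNIV[OF t], of v w] twist_map_F[OF T2_UNIV[OF u], of v w] by simp
  qed
  then show ?thesis by simp
qed

section \<open>Comparison of the graph with the cobracket\<close>

context
  fixes \<delta> :: "'r \<Rightarrow> ('k, 'r) tensor2"
  assumes \<delta>_T2: "a \<in> Rp \<Longrightarrow> \<delta> a \<in> T2 Rp"
    and \<delta>_eval: "a \<in> Rp \<Longrightarrow> v \<in> Rm \<Longrightarrow> w \<in> Rm \<Longrightarrow> \<delta> a (ev v) (ev w) = F a (br v w)"
begin

text \<open>Duality and skewness turn the alternation into minus the three terms of
  \<open>graph_form\<close> with a single \<open>f\<close>; subtracting \<open>cyb\<close> supplies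
  the others.\<close>

lemma twist_equation_eval:
  assumes t: "t \<in> wedge2 scale Rp" and uvw: "u \<in> Rm" "v \<in> Rm" "w \<in> Rm"
  defines "f \<equiv> twist_map scale F t"
  shows "(alt scale (cobracket_id scale Rp \<delta> t) - cyb scale br t) (ev2 u v) (ev w) =
    - F (br (u + f u) (v + f v)) (w + f w)"
proof -
  note T = dual_cobracket_id[OF \<delta>_T2 \<delta>_eval wedge2_T2[OF t]]
  have "t (ev (br x y)) (ev z) = - F (f z) (br x y)" for x y z
    unfolding twist_map_F[OF T2_UNIV[OF wedge2_T2[OF t]], symmetric] f_def by (rule twist_map_skew[OF t])
  then have "alt scale (cobracket_id scale Rp \<delta> t) (ev2 u v) (ev w) =
      - F (f w) (br u v) - F (f u) (br v w) - F (f v) (br w u)"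
    by (simp add: alt_apply[OF T3_UNIV[OF T(1)]] lin_F T(2) uvw)
  then show ?thesis
    unfolding f_def using graph_form[OF t uvw] by simp
qed

lemma twisted_subalgebra_iff:
  assumes t: "t \<in> wedge2 scale Rp"
  shows "lie_subalgebra scale br (twisted scale F Rm t) \<longleftrightarrow>
    alt scale (cobracket_id scale Rp \<delta> t) - cyb scale br t = 0" (is "?L \<longleftrightarrow> ?E = 0")
proof
  let ?f = "twist_map scale F t"
  interpret t: vector_space "tscale :: 'k \<Rightarrow> ('k, 'r) tensor3 \<Rightarrow> _" by (rule vector_space_tscale)
  have mem: "w + ?f w \<in> twisted scale F Rm t" if "w \<in> Rm" for w
    unfolding twisted_def using that by blast
  assume L: ?L
  show "?E = 0"
  proof (rule separated3)
    show "?E \<in> T3 Rp"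
      by (intro t.subspace_diff[OF subspace_T3] alt_in_T3 subspaces cyb_in_T3 wedge2_T2[OF t]
          dual_cobracket_id[OF \<delta>_T2 \<delta>_eval])
    fix u v w assume uvw: "u \<in> Rm" "v \<in> Rm" "w \<in> Rm"
    have "br (u + ?f u) (v + ?f v) \<in> twisted scale F Rm t"
      using L mem uvw unfolding lie_subalgebra_def by blast
    then show "?E (ev2 u v) (ev w) = 0"
      using twist_equation_eval[OF t uvw] twisted_isotropic[OF t _ mem[OF uvw(3)]] by simp
  qed
next
  assume E: "?E = 0"
  have "br x y \<in> twisted scale F Rm t"
    if "x \<in> twisted scale F Rm t" "y \<in> twisted scale F Rm t" for x y
  proof (rule twisted_lagrangian[OF t])
    fix z assume "z \<in> twisted scale F Rm t"
    with that obtain u v w where "u \<in> Rm" "v \<in> Rm" "w \<in> Rm" "x = u + twist_map scale F t u"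
      "y = v + twist_map scale F t v" "z = w + twist_map scale F t w"
      unfolding twisted_def by blast
    then show "F (br x y) z = 0"
      using twist_equation_eval[OF t, of u v w] unfolding E by simp
  qed
  then show ?L
    unfolding lie_subalgebra_def using twisted_subspace[OF T2_UNIV[OF wedge2_T2[OF t]]] by blast
qed

text \<open>By \<open>dual_determines\<close> for the new triple, only the pairing with the bracket
  on the graph has to be checked. The two mixed brackets in the expansion of \<open>br x y\<close>
  account for the inner cobracket of \<open>t\<close>.\<close>

lemma twisted_determines:
  assumes t: "t \<in> wedge2 scale Rp" and sub: "lie_subalgebra scale br (twisted scale F Rm t)"
  shows "determines_cobracket scale br F Rp (twisted scale F Rm t) (\<lambda>a. \<delta> a + inner_cobracket scale br t a)"
proof -
  let ?f = "twist_map scale F t"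
  let ?\<delta> = "\<lambda>a. \<delta> a + inner_cobracket scale br t a"
  interpret W: manin scale br F Rp "twisted scale F Rm t"
    by unfold_locales (rule twisted_manin[OF assms])
  interpret t: vector_space "tscale :: 'k \<Rightarrow> ('k, 'r) tensor2 \<Rightarrow> _" by (rule vector_space_tscale)
  note f = twist_map_in[OF wedge2_T2[OF t]]
  have T2: "?\<delta> a \<in> T2 Rp" if "a \<in> Rp" for a
    unfolding inner_cobracket_def
    by (intro t.subspace_add[OF subspace_T2] subspaces \<delta>_T2 diag_action_in_T2 wedge2_T2[OF t] that)
  show ?thesis
  proof (rule W.dual_determines[OF T2])
    fix a x y assume a: "a \<in> Rp" and "x \<in> twisted scale F Rm t" "y \<in> twisted scale F Rm t"
    then obtain v w where v: "v \<in> Rm" "x = v + ?f v" and w: "w \<in> Rm" "y = w + ?f w"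
      unfolding twisted_def by blast
    have "?\<delta> a (ev x) (ev y) = ?\<delta> a (ev v) (ev w)"
      unfolding v(2) w(2) eval_add_Rp[OF T2[OF a] f] ..
    also have "\<dots> = F a (br v w) + t (ev (br v a)) (ev w) + t (ev v) (ev (br w a))"
      by (simp add: inner_cobracket_def diag_action_eval[OF T2_UNIV[OF wedge2_T2[OF t]]] \<delta>_eval a v w)
    also have "\<dots> = F a (br v w) - F (?f w) (br v a) + F (?f v) (br w a)"
      using twist_map_skew[OF t, of "br v a" w]
      by (simp add: twist_map_F[OF T2_UNIV[OF wedge2_T2[OF t]]])
    also have "\<dots> = F a (br v w) + F (br v (?f w)) a + F (br (?f v) w) a"
      using F_rot[of v "?f w" a] F_inv[of "?f v" w a] br_antisym[of a v] by (simp add: F_minus)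
    \<comment> \<open>The remaining bracket \<open>br (?f v) (?f w)\<close> contributes nothing,
      since it lies in the isotropic \<open>Rp\<close> together with \<open>a\<close>.\<close>
    also have "\<dots> = F a (br x y)"
      by (simp add: v w br_lin F_lin isotropic br_closed f a F_sym)
    finally show "?\<delta> a (ev x) (ev y) = F a (br x y)" .
  qed
qed

end

section \<open>Commensurability and finite rank\<close>

text \<open>Equality of cosets is congruence modulo \<open>N\<close>, so the quotient can be handled
  through spans in the ambient space.\<close>

lemma finite_dim_quotient_iff:
  assumes "subspace N"
  shows "finite_dim_quotient scale U N \<longleftrightarrow>
    (\<exists>B. finite B \<and> B \<subseteq> U \<and> (\<forall>u\<in>U. \<exists>s\<in>span B. u - s \<in> N))"
proof -
  have coset: "coset N u = coset N v \<longleftrightarrow> u - v \<in> N" for u v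
  proof
    assume eq: "coset N u = coset N v"
    have "u + 0 \<in> coset N u" unfolding coset_def using subspace_0[OF assms] by blast
    then obtain x where "x \<in> N" "u = v + x" unfolding eq unfolding coset_def by auto
    then show "u - v \<in> N" by simp
  next
    assume uv: "u - v \<in> N"
    have "u + x = v + ((u - v) + x)" "v + x = u + (x - (u - v))" for x by simp_all
    then show "coset N u = coset N v"
      unfolding coset_def using subspace_add[OF assms uv] subspace_diff[OF assms _ uv] by blast
  qed
  have "(\<exists>c. u - (\<Sum>b\<in>B. scale (c b) b) \<in> N) \<longleftrightarrow> (\<exists>s\<in>span B. u - s \<in> N)" if "finite B" for u B
    unfolding span_finite[OF that] by blast
  then show ?thesis unfolding finite_dim_quotient_def coset by (simp cong: conj_cong)
qed

text \<open>The kernel of the twist map on \<open>Rm\<close> lies in both subspaces and has finite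
  codimension in \<open>Rm\<close>, because the values lie in the span of the finitely many
  \<open>b i\<close>. Preimages \<open>X\<close> of a basis of the range, together with that basis,
  span the sum modulo the intersection.\<close>

lemma twisted_commensurable:
  assumes t: "t \<in> T2 Rp"
  shows "commensurable scale (twisted scale F Rm t) Rm"
proof -
  let ?f = "twist_map scale F t" and ?W = "twisted scale F Rm t"
  let ?U = "{x + y | x y. x \<in> ?W \<and> y \<in> Rm}"
  obtain n a b where tab: "t = (\<Sum>i<(n::nat). tens scale scale (a i) (b i))"
    using t by (blast elim: tensor_prodE)
  have lin: "Vector_Spaces.linear scale scale ?f"
    unfolding Vector_Spaces.linear_iff using vector_space_axioms twist_map_lin[OF T2_UNIV[OF t]] by blast
  interpret f: Vector_Spaces.linear scale scale ?f by (rule lin)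
  have "?f w \<in> span (b ` {..<n})" for w
    unfolding tab twist_map_sum by (intro span_sum span_scale span_base) auto
  then have rank: "?f ` Rm \<subseteq> span (b ` {..<n})" by blast
  obtain C where C: "C \<subseteq> ?f ` Rm" "independent C" "?f ` Rm \<subseteq> span C"
    by (rule basis_exists)
  have "finite C"
    using independent_span_bound[of "b ` {..<n}" C] C rank by auto
  then obtain X where X: "X \<subseteq> Rm" "finite X" "C = ?f ` X"
    using C(1) finite_subset_image[of C ?f Rm] by blast
  have ker: "\<exists>x\<in>span X. w - x \<in> ?W \<inter> Rm \<and> ?f w = ?f x" if "w \<in> Rm" for w
  proof -
    have "?f w \<in> ?f ` span X" using that C(3) f.span_image[of X] X(3) by blast
    then obtain x where x: "x \<in> span X" "?f w = ?f x" by blast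
    have "x \<in> Rm" using x(1) span_minimal[OF X(1) subspaces(2)] by blast
    then have "w - x \<in> Rm" using that subspace_diff subspaces(2) by blast
    moreover from this have "w - x \<in> ?W"
      unfolding twisted_def using x(2) f.diff[of w x] by force
    ultimately show ?thesis using x by blast
  qed
  have sub: "subspace (?W \<inter> Rm)"
    by (intro subspace_inter twisted_subspace T2_UNIV[OF t] subspaces)
  have Rm_U: "w \<in> ?U" "?f w \<in> ?U" if "w \<in> Rm" for w
  proof -
    have "0 \<in> ?W" using twisted_subspace[OF T2_UNIV[OF t]] subspace_0 by blast
    then show "w \<in> ?U" using that by force
    have "w + ?f w \<in> ?W" "- w \<in> Rm" "?f w = (w + ?f w) + - w"
      unfolding twisted_def using that subspace_neg[OF subspaces(2)] by auto
    then show "?f w \<in> ?U" by blast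
  qed
  have "\<exists>s\<in>span (X \<union> ?f ` X). u - s \<in> ?W \<inter> Rm" if u: "u \<in> ?U" for u
  proof -
    obtain w v where wv: "w \<in> Rm" "v \<in> Rm" "u = (w + ?f w) + v"
      using u unfolding twisted_def by blast
    \<comment> \<open>\<open>u\<close> is the sum of \<open>w + v\<close>, which is congruent to a
      vector of \<open>span X\<close>, and of \<open>?f w\<close>, which lies in the span of the
      basis.\<close>
    have "w + v \<in> Rm" using wv subspace_add[OF subspaces(2)] by blast
    from ker[OF this] obtain x where x: "x \<in> span X" "(w + v) - x \<in> ?W \<inter> Rm" by blast
    have "?f w \<in> span (?f ` X)" using C(3) X(3) wv(1) by blast
    then have "x + ?f w \<in> span (X \<union> ?f ` X)"
      using x(1) span_mono[of X "X \<union> ?f ` X"] span_mono[of "?f ` X" "X \<union> ?f ` X"]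
      by (intro span_add) auto
    moreover have "u - (x + ?f w) = (w + v) - x" unfolding wv(3) by (simp add: algebra_simps)
    then have "u - (x + ?f w) \<in> ?W \<inter> Rm" using x(2) by (simp only:)
    ultimately show ?thesis by blast
  qed
  moreover have "X \<union> ?f ` X \<subseteq> ?U"
    using X(1) by (intro Un_least image_subsetI) (use Rm_U in \<open>simp_all add: subset_iff del: mem_Collect_eq\<close>)
  ultimately show ?thesis
    unfolding commensurable_def finite_dim_quotient_iff[OF sub] using X(2)
    by (intro exI[of _ "X \<union> ?f ` X"] conjI ballI) simp_all
qed

text \<open>Biorthogonalisation by induction; the new vector comes from the separation of
  \<open>Rp\<close> by \<open>Rm\<close>.\<close>

lemma dual_family:
  assumes "finite C" "independent C" "C \<subseteq> Rp"
  shows "\<exists>v. \<forall>c\<in>C. v c \<in> Rm \<and> (\<forall>c'\<in>C. F c' (v c) = (if c' = c then 1 else 0))"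
  using assms
proof (induction C)
  case (insert b C)
  have "independent C" "b \<notin> span C" using insert.prems(1) insert.hyps independent_insert by auto
  then obtain v where v: "\<And>c. c \<in> C \<Longrightarrow> v c \<in> Rm"
      "\<And>c c'. c \<in> C \<Longrightarrow> c' \<in> C \<Longrightarrow> F c' (v c) = (if c' = c then 1 else 0)"
    using insert by auto
  \<comment> \<open>Every \<open>v c\<close> annihilates \<open>d\<close>. It is nonzero because
    \<open>b\<close> is outside the span of \<open>C\<close>, so some \<open>w\<close> in
    \<open>Rm\<close> detects it.\<close>
  define d where "d = b - (\<Sum>c\<in>C. scale (F b (v c)) c)"
  have "(\<Sum>c\<in>C. scale (F b (v c)) c) \<in> span C" by (intro span_sum span_scale span_base)
  then have "d \<noteq> 0" using \<open>b \<notin> span C\<close> unfolding d_def by auto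
  moreover have "d \<in> Rp"
    unfolding d_def using insert.prems(2) by (intro subspace_diff subspace_sum subspace_scale subspaces) auto
  ultimately obtain w where w: "w \<in> Rm" "F d w \<noteq> 0" using separated by blast
  \<comment> \<open>The correction makes \<open>w'\<close> orthogonal to \<open>C\<close>, and its
    pairing with \<open>b\<close> becomes the nonzero number \<open>F d w\<close>.\<close>
  define w' where "w' = w - (\<Sum>c\<in>C. scale (F c w) (v c))"
  have w'_Rm: "w' \<in> Rm"
    unfolding w'_def using w v(1) by (intro subspace_diff subspace_sum subspace_scale subspaces) auto
  have w'_C: "F c w' = 0" if "c \<in> C" for c
  proof -
    have "(\<Sum>x\<in>C. F x w * F c (v x)) = (\<Sum>x\<in>C. if c = x then F c w else 0)"
      using v(2) that by (intro sum.cong) auto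
    then show ?thesis using that insert.hyps(1) by (simp add: w'_def F_diff F_sum F_lin)
  qed
  have "F b w' = F d w" by (simp add: w'_def d_def F_diff F_sum F_lin mult.commute)
  define e where "e = scale (inverse (F d w)) w'"
  have e: "e \<in> Rm" "F b e = 1" "\<And>c. c \<in> C \<Longrightarrow> F c e = 0"
    using w'_Rm subspace_scale[OF subspaces(2)] w'_C w(2) \<open>F b w' = F d w\<close>
    by (auto simp: e_def F_lin)
  \<comment> \<open>The old vectors are corrected so as to annihilate \<open>b\<close>; as
    \<open>e\<close> annihilates \<open>C\<close>, their values on \<open>C\<close> stay the
    same.\<close>
  let ?v = "\<lambda>c. if c = b then e else v c - scale (F b (v c)) e"
  have "?v c \<in> Rm \<and> (\<forall>c'\<in>insert b C. F c' (?v c) = (if c' = c then 1 else 0))" if "c \<in> insert b C" for c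
    using that e v insert.hyps(2)
    by (auto simp: F_diff F_lin intro!: subspace_diff[OF subspaces(2)] subspace_scale[OF subspaces(2)])
  then show ?case by (intro exI[of _ ?v]) blast
qed simp

text \<open>For the skew map \<open>f\<close> with graph \<open>W\<close> and a
  dual family \<open>v\<close> of a basis \<open>C\<close> of a space containing the range of \<open>f\<close>, skewness gives
  \<open>f w = (\<Sum>c\<in>C. F (f w) (v c) c) = (\<Sum>c\<in>C. F w (- f (v c)) c)\<close>, which exhibits the tensor.\<close>

lemma MT_is_twisted:
  assumes "W \<in> MT scale br F Rp Rm"
  shows "\<exists>t\<in>wedge2 scale Rp. twisted scale F Rm t = W"
proof -
  have "manin_triple scale br F Rp W" and comm: "commensurable scale W Rm"
    using assms unfolding MT_def by blast+
  then interpret W: manin scale br F Rp W by unfold_locales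
  \<comment> \<open>The decomposition along \<open>Rp\<close> and \<open>W\<close> yields the map
    whose graph over \<open>Rm\<close> is \<open>W\<close>. It is chosen pointwise; its skewness
    comes from the isotropy of \<open>W\<close>.\<close>
  have "\<exists>p\<in>Rp. w + p \<in> W" for w
  proof -
    obtain p m where "p \<in> Rp" "m \<in> W" "w = p + m" by (rule W.decompose)
    then show ?thesis using subspace_neg[OF subspaces(1)] by (intro bexI[of _ "- p"]) auto
  qed
  then obtain f where f: "\<And>w. f w \<in> Rp" "\<And>w. w + f w \<in> W" by metis
  have skew: "F (f w) v = - F (f v) w" if "v \<in> Rm" "w \<in> Rm" for v w
  proof -
    have "F (w + f w) (v + f v) = 0" using f(2) W.isotropic(2) by blast
    then have "F (f w) v + F w (f v) = 0" using that by (simp add: F_lin isotropic f add.commute)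
    then have "F (f w) v = - F w (f v)" by (simp only: eq_neg_iff_add_eq_0)
    also have "F w (f v) = F (f v) w" by (rule F_sym)
    finally show ?thesis .
  qed
  have "subspace (W \<inter> Rm)" by (intro subspace_inter W.subspaces subspaces)
  with comm obtain B where B: "finite B"
      "\<forall>u\<in>{x + y | x y. x \<in> W \<and> y \<in> Rm}. \<exists>s\<in>span B. u - s \<in> W \<inter> Rm"
    unfolding commensurable_def by (simp only: finite_dim_quotient_iff) (elim exE conjE)
  have "\<exists>p\<in>Rp. b - p \<in> Rm" for b
  proof -
    obtain p m where "p \<in> Rp" "m \<in> Rm" "b = p + m" by (rule decompose)
    then show ?thesis by (intro bexI[of _ p]) simp_all
  qed
  \<comment> \<open>\<open>\<pi> b\<close> is the component of \<open>b\<close> in \<open>Rp\<close>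
    along \<open>Rm\<close>. The spanning set \<open>B\<close> need not lie in \<open>Rp\<close>, so
    it is projected there.\<close>
  then obtain \<pi> where \<pi>: "\<And>b. \<pi> b \<in> Rp" "\<And>b. b - \<pi> b \<in> Rm" by metis
  have project: "\<exists>p\<in>span (\<pi> ` B). s - p \<in> Rm" if "s \<in> span B" for s
    using that
  proof (induction rule: span_induct_alt)
    case base
    show ?case using span_zero subspace_0[OF subspaces(2)] by force
  next
    case (step c b s)
    then obtain p where p: "p \<in> span (\<pi> ` B)" "s - p \<in> Rm" by blast
    have "scale c (b - \<pi> b) + (s - p) \<in> Rm"
      by (intro subspace_add subspace_scale subspaces p \<pi>)
    moreover have "scale c (b - \<pi> b) + (s - p) = scale c b + s - (scale c (\<pi> b) + p)"
      by (simp add: scale_right_diff_distrib algebra_simps)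
    moreover have "scale c (\<pi> b) + p \<in> span (\<pi> ` B)"
      using step p by (intro span_add span_scale) (auto intro: span_base)
    ultimately show ?case by force
  qed
  have rank: "f w \<in> span (\<pi> ` B)" if "w \<in> Rm" for w
  proof -
    have "f w = (w + f w) + - w" "- w \<in> Rm" using that subspace_neg[OF subspaces(2)] by auto
    then have "f w \<in> {x + y | x y. x \<in> W \<and> y \<in> Rm}" using f(2) by blast
    then obtain s where s: "s \<in> span B" "f w - s \<in> Rm" using B(2) by blast
    obtain p where p: "p \<in> span (\<pi> ` B)" "s - p \<in> Rm" using project[OF s(1)] by blast
    \<comment> \<open>\<open>f w\<close> and \<open>p\<close> both lie in \<open>Rp\<close> and
      differ by an element of \<open>Rm\<close>, so they coincide.\<close>
    have "(f w - s) + (s - p) \<in> Rm" using s(2) p(2) subspace_add[OF subspaces(2)] by blast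
    moreover have "p \<in> Rp" using p(1) span_minimal[of "\<pi> ` B" Rp] \<pi>(1) subspaces(1) by blast
    then have "f w - p \<in> Rp" using f(1) subspace_diff[OF subspaces(1)] by blast
    ultimately have "f w - p = 0" by (intro inter) simp_all
    then show ?thesis using p(1) by simp
  qed
  \<comment> \<open>Dual vectors exist only for an independent family, so the spanning set is
    thinned to a basis.\<close>
  obtain C where C: "C \<subseteq> \<pi> ` B" "independent C" "\<pi> ` B \<subseteq> span C"
    by (rule basis_exists)
  have C_fin: "finite C" using C(1) B(1) finite_subset by blast
  have C_Rp: "C \<subseteq> Rp" using C(1) \<pi>(1) by blast
  have f_C: "f w \<in> span C" if "w \<in> Rm" for w
    using rank[OF that] span_minimal[OF C(3) subspace_span] by blast
  obtain v where v: "\<And>c. c \<in> C \<Longrightarrow> v c \<in> Rm"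
      "\<And>c c'. c \<in> C \<Longrightarrow> c' \<in> C \<Longrightarrow> F c' (v c) = (if c' = c then 1 else 0)"
    using dual_family[OF C_fin C(2) C_Rp] by blast
  have expand: "(\<Sum>c\<in>C. scale (F x (v c)) c) = x" if "x \<in> span C" for x
  proof -
    obtain k where k: "x = (\<Sum>c\<in>C. scale (k c) c)"
      using \<open>x \<in> span C\<close> unfolding span_finite[OF C_fin] by blast
    have "F x (v c) = k c" if "c \<in> C" for c
    proof -
      have "(\<Sum>c'\<in>C. k c' * F c' (v c)) = (\<Sum>c'\<in>C. if c' = c then k c else 0)"
        using v(2) that by (intro sum.cong) auto
      then show ?thesis using that C_fin by (simp add: k F_sum F_lin)
    qed
    then show ?thesis using k by simp
  qed
  define t where "t = (\<Sum>c\<in>C. tens scale scale (- f (v c)) c)"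
  interpret t: vector_space "tscale :: 'k \<Rightarrow> ('k, 'r) tensor2 \<Rightarrow> _" by (rule vector_space_tscale)
  have t_T2: "t \<in> T2 Rp"
    unfolding t_def using C_Rp f(1) subspace_neg[OF subspaces(1)]
    by (intro t.subspace_sum[OF subspace_T2] subspaces tens_in_tensor_prod) auto
  have t_eval: "t (ev w) (ev u) = F (f w) u" if "w \<in> Rm" "u \<in> Rm" for w u
  proof -
    have "t (ev w) (ev u) = (\<Sum>c\<in>C. F (f w) (v c) * F c u)"
      unfolding t_def by (simp add: sum_fun_apply2 tens_apply lin_F F_minus skew[OF v(1) that(1)])
    also have "\<dots> = F (\<Sum>c\<in>C. scale (F (f w) (v c)) c) u" by (simp add: F_sum F_lin)
    finally show ?thesis using expand[OF f_C[OF that(1)]] by simp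
  qed
  have "t \<in> wedge2 scale Rp"
    by (rule wedge2I[OF t_T2]) (simp only: t_eval, rule skew)
  have twist: "twist_map scale F t w = f w" if "w \<in> Rm" for w
  proof -
    have "twist_map scale F t w - f w = 0"
      using twist_map_F[OF T2_UNIV[OF t_T2]] t_eval[OF that]
      by (intro separated subspace_diff subspaces twist_map_in[OF t_T2] f) (simp add: F_diff)
    then show ?thesis by simp
  qed
  have "twisted scale F Rm t = W"
  proof
    show "twisted scale F Rm t \<subseteq> W" unfolding twisted_def using twist f(2) by auto
    show "W \<subseteq> twisted scale F Rm t"
    proof
      fix x assume "x \<in> W"
      obtain p w where pw: "p \<in> Rp" "w \<in> Rm" "x = p + w" by (rule decompose)
      \<comment> \<open>This difference equals \<open>p - f w\<close>, so it lies in both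
        \<open>W\<close> and \<open>Rp\<close>, which meet in 0.\<close>
      have "x - (w + f w) \<in> W" using \<open>x \<in> W\<close> f(2) subspace_diff[OF W.subspaces(2)] by blast
      then have "p - f w \<in> W" by (simp add: pw)
      moreover have "p - f w \<in> Rp" using pw f(1) subspace_diff[OF subspaces(1)] by blast
      ultimately have "p - f w = 0" by (intro W.inter)
      then have "x = w + twist_map scale F t w" using pw twist by (simp add: add.commute)
      then show "x \<in> twisted scale F Rm t" unfolding twisted_def using pw(2) by blast
    qed
  qed
  then show ?thesis using \<open>t \<in> wedge2 scale Rp\<close> by blast
qed

end

theorem theorem2p10:
  fixes scale :: "'k::field \<Rightarrow> 'r::ab_group_add \<Rightarrow> 'r"
    and br :: "'r \<Rightarrow> 'r \<Rightarrow> 'r"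
    and F :: "'r \<Rightarrow> 'r \<Rightarrow> 'k"
    and Rp Rm :: "'r set"
    and \<delta> :: "'r \<Rightarrow> ('k, 'r) tensor2"
  assumes "CHAR('k) \<noteq> 2"
    and "manin_triple scale br F Rp Rm"
    and "determines_cobracket scale br F Rp Rm \<delta>"
  shows "(\<forall>t \<in> wedge2 scale Rp.
            lie_subalgebra scale br (twisted scale F Rm t) \<longleftrightarrow>
              alt scale (cobracket_id scale Rp \<delta> t) - cyb scale br t = 0) \<and>
         bij_betw (\<lambda>t. twisted scale F Rm t)
           {t \<in> wedge2 scale Rp. alt scale (cobracket_id scale Rp \<delta> t) - cyb scale br t = 0}
           (MT scale br F Rp Rm) \<and>
         (\<forall>t \<in> wedge2 scale Rp.
            alt scale (cobracket_id scale Rp \<delta> t) - cyb scale br t = 0 \<longrightarrow>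
              determines_cobracket scale br F Rp (twisted scale F Rm t)
                (\<lambda>a. \<delta> a + inner_cobracket scale br t a))"
proof -
  interpret manin scale br F Rp Rm by unfold_locales (rule assms(2))
  have T2: "\<delta> a \<in> T2 Rp" if "a \<in> Rp" for a
    using assms(3) that unfolding determines_cobracket_def lie_bialgebra_def by (blast intro: wedge2_T2)
  have eval: "\<delta> a (ev v) (ev w) = F a (br v w)" if "a \<in> Rp" "v \<in> Rm" "w \<in> Rm" for a v w
    using assms(3) that form2_eq[OF T2_UNIV[OF T2], of a v w] unfolding determines_cobracket_def by simp
  note iff = twisted_subalgebra_iff[OF T2 eval]
  let ?E = "\<lambda>t. alt scale (cobracket_id scale Rp \<delta> t) - cyb scale br t = 0"
  have "bij_betw (\<lambda>t. twisted scale F Rm t) {t \<in> wedge2 scale Rp. ?E t} (MT scale br F Rp Rm)"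
  proof (rule bij_betw_imageI)
    show "inj_on (\<lambda>t. twisted scale F Rm t) {t \<in> wedge2 scale Rp. ?E t}"
      by (rule inj_onI) (auto intro: twisted_inj wedge2_T2)
    show "(\<lambda>t. twisted scale F Rm t) ` {t \<in> wedge2 scale Rp. ?E t} = MT scale br F Rp Rm"
    proof
      show "(\<lambda>t. twisted scale F Rm t) ` {t \<in> wedge2 scale Rp. ?E t} \<subseteq> MT scale br F Rp Rm"
        unfolding MT_def using twisted_manin iff twisted_commensurable[OF wedge2_T2] by blast
      show "MT scale br F Rp Rm \<subseteq> (\<lambda>t. twisted scale F Rm t) ` {t \<in> wedge2 scale Rp. ?E t}"
      proof
        fix W assume W: "W \<in> MT scale br F Rp Rm"
        then obtain t where t: "t \<in> wedge2 scale Rp" "twisted scale F Rm t = W"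
          using MT_is_twisted by blast
        \<comment> \<open>Here the graph is a subalgebra from the outset, so the equivalence
          delivers the twist equation for its tensor.\<close>
        have "lie_subalgebra scale br W" using W unfolding MT_def manin_triple_def by blast
        then have "?E t" using iff[OF _ _ _ _ t(1)] t(2) by blast
        then show "W \<in> (\<lambda>t. twisted scale F Rm t) ` {t \<in> wedge2 scale Rp. ?E t}" using t by blast
      qed
    qed
  qed
  then show ?thesis using iff twisted_determines[OF T2 eval] by blast
qed

end
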